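(* Let $G$ be a locally compact, locally trivial groupoid with unit space $G^{(0)}$, let $\nu$ be a fully supported positive Radon measure on $G^{(0)}$, and fix $x\in G^{(0)}$. For $v\in G^{(0)}$ define $\lambda_G^v$ by $$\int_G f\,d\lambda_G^v=\int_{G^{(0)}}\Big(\sum_{\gamma\in G^x_w} f(\eta^{-1}\gamma)\Big)\,d\nu(w),\qquad f\in C_c(G),$$ where $\eta\in G^x_v$ is any chosen arrow. Then $\lambda_G=\{\lambda_G^v\}_{v\in G^{(0)}}$ is a Haar system on $G$.
   Context: **Groupoids.** For a groupoid $G$ with range and source maps $r,s\colon G\to G^{(0)}$ (arrows compose right to left: $\gamma\eta$ is defined iff $s(\gamma)=r(\eta)$), put $G^x=r^{-1}(x)$, $G_y=s^{-1}(y)$, $G^x_y=G^x\cap G_y$. A topological groupoid is a groupoid with a topology for which $r$, $s$, inversion and multiplication are continuous ($G^{(0)}\subseteq G$ with the subspace topology). It is called locally compact if its topology is locally compact (not assumed Hausdorff, but locally Hausdorff: every point has a compact Hausdorff neighbourhood) and its unit space $G^{(0)}$ is Hausdorff. $G$ is locally trivial if for every $x\in G^{(0)}$ the restricted source map $s|_{G^x}\colon G^x\to G^{(0)}$ is a surjective local homeomorphism; in particular every $G^x_w=(s|_{G^x})^{-1}(w)$ is nonempty. **Haar system.** A Haar system on $G$ is a family $\{\alpha^u\}_{u\in G^{(0)}}$ of positive Radon measures on $G$ such that: $\alpha^u$ has support $G^u$; for every $f\in C_c(G)$ the function $u\mapsto\int f\,d\alpha^u$ is in $C_c(G^{(0)})$;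 and for all $\gamma\in G$, $f\in C_c(G)$, $\int_{G^{s(\gamma)}} f(\gamma\eta)\,d\alpha^{s(\gamma)}(\eta)=\int_{G^{r(\gamma)}} f(\eta)\,d\alpha^{r(\gamma)}(\eta)$. *)

theory Defs
  imports "HOL-Analysis.Analysis"
begin

section \<open>Topological groupoids\<close>

text \<open>
  The set of arrows is the topspace of \<open>gtop G\<close>, and the units form a subset of it.
  The values of the structure maps outside their domains of definition are irrelevant;
  \<open>\<gamma> \<cdot> \<eta>\<close> is meaningful iff \<open>src \<gamma> = rng \<eta>\<close>.
\<close>

record 'g top_groupoid =
  gtop :: "'g topology"
  units :: "'g set"
  rng :: "'g \<Rightarrow> 'g"
  src :: "'g \<Rightarrow> 'g"
  ginv :: "'g \<Rightarrow> 'g"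
  gmult :: "'g \<Rightarrow> 'g \<Rightarrow> 'g" (infixl \<open>\<cdot>\<index>\<close> 70)

abbreviation arrows :: "'g top_groupoid \<Rightarrow> 'g set"
  where "arrows G \<equiv> topspace (gtop G)"

definition unit_space :: "'g top_groupoid \<Rightarrow> 'g topology"
  where "unit_space G = subtopology (gtop G) (units G)"

definition range_fibre :: "'g top_groupoid \<Rightarrow> 'g \<Rightarrow> 'g set"
  where "range_fibre G x = {\<gamma> \<in> arrows G. rng G \<gamma> = x}"

definition source_fibre :: "'g top_groupoid \<Rightarrow> 'g \<Rightarrow> 'g set"
  where "source_fibre G y = {\<gamma> \<in> arrows G. src G \<gamma> = y}"

text \<open>\<open>hom_fibre G x y\<close> is $G^x_y$: the arrows with range \<open>x\<close> and source \<open>y\<close>.\<close>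

definition hom_fibre :: "'g top_groupoid \<Rightarrow> 'g \<Rightarrow> 'g \<Rightarrow> 'g set"
  where "hom_fibre G x y = range_fibre G x \<inter> source_fibre G y"

definition composable :: "'g top_groupoid \<Rightarrow> ('g \<times> 'g) set"
  where "composable G = {(\<gamma>, \<eta>). \<gamma> \<in> arrows G \<and> \<eta> \<in> arrows G \<and> src G \<gamma> = rng G \<eta>}"

locale groupoid =
  fixes G :: "'g top_groupoid" (structure)
  assumes units_subset: "units G \<subseteq> arrows G"
    and rng_closed: "\<gamma> \<in> arrows G \<Longrightarrow> rng G \<gamma> \<in> units G"
    and src_closed: "\<gamma> \<in> arrows G \<Longrightarrow> src G \<gamma> \<in> units G"
    and rng_unit: "u \<in> units G \<Longrightarrow> rng G u = u"
    and src_unit: "u \<in> units G \<Longrightarrow> src G u = u"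
    and mult_closed: "(\<gamma>, \<eta>) \<in> composable G \<Longrightarrow> \<gamma> \<cdot> \<eta> \<in> arrows G"
    and rng_mult: "(\<gamma>, \<eta>) \<in> composable G \<Longrightarrow> rng G (\<gamma> \<cdot> \<eta>) = rng G \<gamma>"
    and src_mult: "(\<gamma>, \<eta>) \<in> composable G \<Longrightarrow> src G (\<gamma> \<cdot> \<eta>) = src G \<eta>"
    and mult_assoc: "(\<gamma>, \<eta>) \<in> composable G \<Longrightarrow> (\<eta>, \<zeta>) \<in> composable G \<Longrightarrow>
          (\<gamma> \<cdot> \<eta>) \<cdot> \<zeta> = \<gamma> \<cdot> (\<eta> \<cdot> \<zeta>)"
    and mult_left_unit: "\<gamma> \<in> arrows G \<Longrightarrow> rng G \<gamma> \<cdot> \<gamma> = \<gamma>"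
    and mult_right_unit: "\<gamma> \<in> arrows G \<Longrightarrow> \<gamma> \<cdot> src G \<gamma> = \<gamma>"
    and inv_closed: "\<gamma> \<in> arrows G \<Longrightarrow> ginv G \<gamma> \<in> arrows G"
    and rng_inv: "\<gamma> \<in> arrows G \<Longrightarrow> rng G (ginv G \<gamma>) = src G \<gamma>"
    and src_inv: "\<gamma> \<in> arrows G \<Longrightarrow> src G (ginv G \<gamma>) = rng G \<gamma>"
    and mult_right_inv: "\<gamma> \<in> arrows G \<Longrightarrow> \<gamma> \<cdot> ginv G \<gamma> = rng G \<gamma>"
    and mult_left_inv: "\<gamma> \<in> arrows G \<Longrightarrow> ginv G \<gamma> \<cdot> \<gamma> = src G \<gamma>"

locale topological_groupoid = groupoid +
  assumes continuous_rng: "continuous_map (gtop G) (unit_space G) (rng G)"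
    and continuous_src: "continuous_map (gtop G) (unit_space G) (src G)"
    and continuous_inv: "continuous_map (gtop G) (gtop G) (ginv G)"
    and continuous_mult: "continuous_map
          (subtopology (prod_topology (gtop G) (gtop G)) (composable G)) (gtop G)
          (\<lambda>(\<gamma>, \<eta>). \<gamma> \<cdot> \<eta>)"

locale locally_compact_groupoid = topological_groupoid +
  assumes compact_Hausdorff_nbhd: "\<gamma> \<in> arrows G \<Longrightarrow>
      \<exists>U K. openin (gtop G) U \<and> \<gamma> \<in> U \<and> U \<subseteq> K \<and> compactin (gtop G) K \<and>
            Hausdorff_space (subtopology (gtop G) K)"
    and Hausdorff_unit_space: "Hausdorff_space (unit_space G)"

definition local_homeomorphism :: "'a topology \<Rightarrow> 'b topology \<Rightarrow> ('a \<Rightarrow> 'b) \<Rightarrow> bool"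
  where "local_homeomorphism X Y f \<longleftrightarrow>
    (\<forall>p \<in> topspace X. \<exists>U V. openin X U \<and> p \<in> U \<and> openin Y V \<and>
       homeomorphic_map (subtopology X U) (subtopology Y V) f)"

definition locally_trivial :: "'g top_groupoid \<Rightarrow> bool"
  where "locally_trivial G \<longleftrightarrow>
    (\<forall>x \<in> units G. src G ` range_fibre G x = units G \<and>
       local_homeomorphism (subtopology (gtop G) (range_fibre G x)) (unit_space G) (src G))"

section \<open>Radon measures and Haar systems\<close>

text \<open>
  The two definitions \<open>Cc\<close> and \<open>radon_measure\<close> below are the standard ones for locally compact
  Hausdorff spaces. This is enough here: if \<open>G\<close> is a locally trivial topological groupoid with
  Hausdorff unit space, then \<open>(rng, src)\<close> is locally, over $U \times V$, a projection
  $U \times V \times G^x_x \to U \times V$ with $G^x_x$ discrete, so \<open>G\<close> is itself Hausdorff.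
\<close>

definition Cc :: "'a topology \<Rightarrow> ('a \<Rightarrow> complex) set"
  where "Cc X = {f. continuous_map X euclidean f \<and>
                    compactin X (X closure_of {p \<in> topspace X. f p \<noteq> 0})}"

definition radon_measure :: "'a topology \<Rightarrow> 'a measure \<Rightarrow> bool"
  where "radon_measure X M \<longleftrightarrow>
    space M = topspace X \<and>
    sets M = sigma_sets (topspace X) {U. openin X U} \<and>
    (\<forall>K. compactin X K \<longrightarrow> emeasure M K < \<infinity>) \<and>
    (\<forall>A \<in> sets M. emeasure M A = (INF U \<in> {U. openin X U \<and> A \<subseteq> U}. emeasure M U)) \<and>
    (\<forall>U. openin X U \<longrightarrow> emeasure M U = (SUP K \<in> {K. compactin X K \<and> K \<subseteq> U}. emeasure M K))"

definition measure_support :: "'a topology \<Rightarrow> 'a measure \<Rightarrow> 'a set"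
  where "measure_support X M =
    {p \<in> topspace X. \<forall>U. openin X U \<and> p \<in> U \<longrightarrow> emeasure M U \<noteq> 0}"

definition fully_supported :: "'a topology \<Rightarrow> 'a measure \<Rightarrow> bool"
  where "fully_supported X M \<longleftrightarrow> measure_support X M = topspace X"

definition haar_system :: "'g top_groupoid \<Rightarrow> ('g \<Rightarrow> 'g measure) \<Rightarrow> bool"
  where "haar_system G \<alpha> \<longleftrightarrow>
    (\<forall>u \<in> units G. radon_measure (gtop G) (\<alpha> u) \<and>
                   measure_support (gtop G) (\<alpha> u) = range_fibre G u) \<and>
    (\<forall>f \<in> Cc (gtop G). (\<lambda>u. LINT \<eta>|\<alpha> u. f \<eta>) \<in> Cc (unit_space G)) \<and>
    (\<forall>\<gamma> \<in> arrows G. \<forall>f \<in> Cc (gtop G).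
       (LINT \<eta>:range_fibre G (src G \<gamma>)|\<alpha> (src G \<gamma>). f (\<gamma> \<cdot>\<^bsub>G\<^esub> \<eta>)) =
       (LINT \<eta>:range_fibre G (rng G \<gamma>)|\<alpha> (rng G \<gamma>). f \<eta>))"

text \<open>
  \<open>L\<close> is the Radon measure on \<open>G\<close> whose integral on \<open>Cc\<close> is obtained by translating by
  $\eta^{-1}$, for an arrow \<open>\<eta>\<close> with range \<open>x\<close>, summing over the fibres $G^x_w$, and integrating
  against \<open>\<nu>\<close>.
\<close>

definition is_lambda ::
    "'g top_groupoid \<Rightarrow> 'g measure \<Rightarrow> 'g \<Rightarrow> 'g \<Rightarrow> 'g measure \<Rightarrow> bool"
  where "is_lambda G \<nu> x \<eta> L \<longleftrightarrow>
    radon_measure (gtop G) L \<and>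
    (\<forall>f \<in> Cc (gtop G).
       (LINT \<gamma>|L. f \<gamma>) =
       (LINT w|\<nu>. (\<Sum>\<^sub>\<infinity>\<gamma> \<in> hom_fibre G x w. f (ginv G \<eta> \<cdot>\<^bsub>G\<^esub> \<gamma>))))"

end

(*
  By local triviality, gamma |-> (rng gamma, src gamma) is a local homeomorphism from G to pairs of
  units: if tau is a local section of the source map through the unit u = rng gamma, and sigma one
  through gamma, both into the fibre over u, then (v, w) |-> (tau v)^-1 sigma w is a local inverse
  near gamma. Left translation by tau together with the discreteness of the isotropy groups also
  shows that G is Hausdorff. Hence summing f in C_c(G) over the sets G^v_w gives a function in C_c of
  pairs of units; integrating it against nu in w gives a positive functional on C_c(G) for each v,
  represented by a unique Radon measure lambda^v, and a function in C_c in the parameter v.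
  Invariance holds because left translation by gamma is a bijection from G^{src gamma}_w to
  G^{rng gamma}_w.
*)
theory Submission
  imports Defs
begin

section \<open>Continuous functions with compact support\<close>

text \<open>\<open>Cc\<close> and Radon measures behave well only on Hausdorff spaces, and
  \<open>G\<close> is assumed only locally Hausdorff, so separation of arrows has to be settled
  before any functional on \<open>G\<close> is considered. Nor is \<open>G\<close> assumed
  sigma-compact. The measures are therefore Radon in the sense of outer regularity on Borel sets and
  inner regularity on open sets, and the Riesz theorem is proved in exactly this form: Urysohn
  functions determine the measure of open sets, open supersets determine the rest, so uniqueness
  needs no sigma-finiteness. The sums over fibres are finite in substance: the fibres of a local
  homeomorphism are discrete and a compact set meets each in finitely many points, so near a given
  pair of units the sum is a fixed finite sum of \<open>f\<close> composed with local sections.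
  Invariance has an obstacle of its own. The translate of \<open>f\<close> by an arrow is defined on
  one range fibre only and is no function on \<open>G\<close>, so the integral formula cannot be
  applied to it; it must first be extended to an element of \<open>Cc\<close>, which agrees with it
  almost everywhere because the measure is carried by that fibre.\<close>

definition ccont :: "'a topology \<Rightarrow> ('a \<Rightarrow> 'b::real_normed_vector) \<Rightarrow> bool"
  where "ccont X f \<longleftrightarrow>
    continuous_map X euclidean f \<and> (\<exists>K. compactin X K \<and> (\<forall>p\<in>topspace X - K. f p = 0))"

lemma ccontI:
  "continuous_map X euclidean f \<Longrightarrow> compactin X K \<Longrightarrow>
    (\<And>p. p \<in> topspace X \<Longrightarrow> p \<notin> K \<Longrightarrow> f p = 0) \<Longrightarrow> ccont X f"
  unfolding ccont_def by blast

lemma ccontE: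
  assumes "ccont X f"
  obtains K where "continuous_map X euclidean f" "compactin X K"
    "\<And>p. p \<in> topspace X \<Longrightarrow> p \<notin> K \<Longrightarrow> f p = 0"
  using assms unfolding ccont_def by blast

lemma ccont_cont: "ccont X f \<Longrightarrow> continuous_map X euclidean f"
  unfolding ccont_def by blast

text \<open>In a Hausdorff space the compact set off which \<open>f\<close> vanishes is closed, so
  it contains the closure of the nonvanishing set. \<open>ccont\<close> is the form worked with: any
  compact carrier at hand will do, and values in any normed space cover both the real functions of
  the Riesz theorem and the complex ones of \<open>Cc\<close>.\<close>

lemma Cc_iff_ccont:
  assumes "Hausdorff_space X"
  shows "f \<in> Cc X \<longleftrightarrow> ccont X f"
proof
  assume f: "f \<in> Cc X"
  have "{p \<in> topspace X. f p \<noteq> 0} \<subseteq> X closure_of {p \<in> topspace X. f p \<noteq> 0}"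
    by (rule closure_of_subset) auto
  with f show "ccont X f" unfolding Cc_def ccont_def by blast
next
  assume "ccont X f"
  then obtain K where K: "continuous_map X euclidean f" "compactin X K"
    "\<And>p. p \<in> topspace X \<Longrightarrow> p \<notin> K \<Longrightarrow> f p = 0"
    by (rule ccontE) blast
  have "X closure_of {p \<in> topspace X. f p \<noteq> 0} \<subseteq> K"
    by (rule closure_of_minimal) (use K assms compactin_imp_closedin in auto)
  then show "f \<in> Cc X"
    using K closed_compactin[OF K(2)] by (simp add: Cc_def)
qed

lemma ccont_cong:
  assumes "ccont X f" "\<And>p. p \<in> topspace X \<Longrightarrow> f p = g p"
  shows "ccont X g"
proof -
  obtain K where K: "continuous_map X euclidean f" "compactin X K"
    "\<And>p. p \<in> topspace X \<Longrightarrow> p \<notin> K \<Longrightarrow> f p = 0"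
    using assms(1) by (rule ccontE) blast
  show ?thesis
    by (rule ccontI[OF continuous_map_eq[OF K(1) assms(2)] K(2)]) (use K(3) assms(2) in auto)
qed

lemma ccont_add:
  assumes "ccont X f" "ccont X g"
  shows "ccont X (\<lambda>p. f p + g p)"
proof -
  obtain K L where "compactin X K" "\<And>p. p \<in> topspace X \<Longrightarrow> p \<notin> K \<Longrightarrow> f p = 0"
    "compactin X L" "\<And>p. p \<in> topspace X \<Longrightarrow> p \<notin> L \<Longrightarrow> g p = 0"
    using assms unfolding ccont_def by blast
  then show ?thesis
    using assms[THEN ccont_cont]
    by (intro ccontI[of _ _ "K \<union> L"] continuous_map_add compactin_Un) auto
qed

lemma ccont_zero: "ccont X (\<lambda>p. 0 :: 'b :: real_normed_vector)"
  by (rule ccontI[of _ _ "{}"]) auto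

lemma ccont_sum: "finite S \<Longrightarrow> (\<And>k. k \<in> S \<Longrightarrow> ccont X (f k)) \<Longrightarrow> ccont X (\<lambda>p. \<Sum>k\<in>S. f k p)"
  by (induction S rule: finite_induct) (auto intro!: ccont_add ccont_zero)

lemma ccont_compose:
  assumes "ccont X f" "continuous_on UNIV h" "h 0 = 0"
  shows "ccont X (\<lambda>p. h (f p))"
proof -
  obtain K where K: "continuous_map X euclidean f" "compactin X K"
    "\<And>p. p \<in> topspace X \<Longrightarrow> p \<notin> K \<Longrightarrow> f p = 0"
    using assms(1) by (rule ccontE) blast
  have "continuous_map X euclidean (h \<circ> f)"
    by (rule continuous_map_compose[OF K(1)]) (use assms(2) in simp)
  then show ?thesis using K assms(3) by (intro ccontI[of _ _ K]) (auto simp: o_def)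
qed

lemma ccont_scale: "ccont X f \<Longrightarrow> ccont X (\<lambda>p. c * f p :: 'b :: real_normed_algebra)"
  by (rule ccont_compose[where h = "\<lambda>x. c * x"]) (auto intro!: continuous_intros)

lemma ccont_diff:
  assumes "ccont X f" "ccont X g"
  shows "ccont X (\<lambda>p. f p - g p :: real)"
  using ccont_add[OF assms(1) ccont_scale[OF assms(2), of "-1"]] by simp

text \<open>\<open>subord X U f\<close> is Rudin's $f \prec U$.\<close>

definition subord :: "'a topology \<Rightarrow> 'a set \<Rightarrow> ('a \<Rightarrow> real) \<Rightarrow> bool"
  where "subord X U f \<longleftrightarrow>
    continuous_map X euclideanreal f \<and> (\<forall>p\<in>topspace X. 0 \<le> f p \<and> f p \<le> 1) \<and>
    (\<exists>K. compactin X K \<and> K \<subseteq> U \<and> (\<forall>p\<in>topspace X - K. f p = 0))"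

lemma subord_ccont: "subord X U f \<Longrightarrow> ccont X f"
  unfolding subord_def ccont_def by blast

lemma subord_range: "subord X U f \<Longrightarrow> p \<in> topspace X \<Longrightarrow> 0 \<le> f p \<and> f p \<le> 1"
  unfolding subord_def by blast

lemma subord_mono: "subord X U f \<Longrightarrow> U \<subseteq> V \<Longrightarrow> subord X V f"
  unfolding subord_def by blast

lemma subord_zero: "subord X U f \<Longrightarrow> p \<in> topspace X \<Longrightarrow> p \<notin> U \<Longrightarrow> f p = 0"
  unfolding subord_def by blast

lemma subord_zero_fun: "subord X U (\<lambda>p. 0)"
  unfolding subord_def by (auto intro!: exI[of _ "{}"])

section \<open>Urysohn functions and splitting of compact sets\<close>

lemma locally_compact_Urysohn:
  assumes "locally_compact_space X" "Hausdorff_space X" "compactin X K" "openin X U" "K \<subseteq> U"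
  obtains f where "subord X U f" "\<And>p. p \<in> K \<Longrightarrow> f p = 1"
proof -
  obtain V L where VL: "openin X V" "compactin X L" "closedin X L" "K \<subseteq> V" "V \<subseteq> L"
    using assms locally_compact_space_compact_closed_compact by metis
  have "completely_regular_space X"
    by (simp add: assms completely_regular_eq_regular_space locally_compact_Hausdorff_imp_regular_space)
  moreover have "closedin X (topspace X - (U \<inter> V))"
    using assms VL by blast
  moreover have "disjnt (topspace X - (U \<inter> V)) K"
    using assms VL by (auto simp: disjnt_def)
  ultimately obtain g where g: "continuous_map X (subtopology euclidean {-1..1::real}) g"
     "g ` (topspace X - (U \<inter> V)) \<subseteq> {-1}" "g ` K \<subseteq> {1}"
    using Urysohn_completely_regular_compact_closed[of "-1" 1 X K "topspace X - (U \<inter> V)"] assms(3)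
    by (metis disjnt_sym neg_le_iff_le le_numeral_extra(4) order.trans zero_le_one neg_le_0_iff_le)
  \<comment> \<open>The range \<open>[-1, 1]\<close> lets \<open>g\<close> be cut at an interior
    value: the set where \<open>g\<close> is at least \<open>0\<close> is closed and avoids the set
    where \<open>g = -1\<close>, so it is a compact carrier inside \<open>U\<close>. A cut at the
    bottom of the range would only place the set where \<open>f\<close> is positive inside
    \<open>U\<close>.\<close>
  define f where "f p = max 0 (g p)" for p
  have gc: "continuous_map X euclideanreal g"
    using g(1) continuous_map_in_subtopology by blast
  have g1: "p \<in> topspace X \<Longrightarrow> g p \<le> 1" for p
    using g(1) by (auto simp: continuous_map_in_subtopology)
  let ?M = "{p \<in> topspace X. g p \<in> {0..}}"
  have cM: "closedin X ?M"
    by (rule closedin_continuous_map_preimage[OF gc]) auto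
  have sM: "?M \<subseteq> U \<inter> V" using g(2) by force
  have "compactin X ?M"
    by (rule closed_compactin[OF VL(2) _ cM]) (use sM VL in blast)
  moreover have "continuous_map X euclideanreal f"
    unfolding f_def by (intro continuous_map_real_max gc) simp
  ultimately have "subord X U f"
    unfolding subord_def using sM g1 by (intro conjI exI[of _ ?M]) (auto simp: f_def)
  moreover have "f p = 1" if "p \<in> K" for p using g(3) that by (auto simp: f_def)
  ultimately show thesis using that by blast
qed

lemma compactin_diff_openin:
  assumes "compactin X K" "openin X U"
  shows "compactin X (K - U)"
proof -
  have "K - U = (topspace X - U) \<inter> K"
    using compactin_subset_topspace[OF assms(1)] by blast
  then show ?thesis
    using assms closed_Int_compactin[of X "topspace X - U" K] by auto
qed

text \<open>The compact sets \<open>K - U\<close> and \<open>K - V\<close> are disjoint, so disjoint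
  open sets \<open>P\<close> and \<open>Q\<close> separate them; then \<open>K - P\<close> lies in
  \<open>U\<close>, \<open>K - Q\<close> lies in \<open>V\<close>, and together they exhaust
  \<open>K\<close>.\<close>

lemma compactin_Un_split:
  assumes "Hausdorff_space X" "compactin X K" "openin X U" "openin X V" "K \<subseteq> U \<union> V"
  obtains L M where "compactin X L" "compactin X M" "L \<subseteq> U" "M \<subseteq> V" "K = L \<union> M"
proof -
  have c: "compactin X (K - U)" "compactin X (K - V)"
    using assms compactin_diff_openin by auto
  have "disjnt (K - U) (K - V)" using assms(5) by (auto simp: disjnt_def)
  then obtain P Q where PQ: "openin X P" "openin X Q" "K - U \<subseteq> P" "K - V \<subseteq> Q" "disjnt P Q"
    using assms(1) c unfolding Hausdorff_space_compact_sets by meson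
  have "compactin X (K - P)" "compactin X (K - Q)"
    by (rule compactin_diff_openin[OF assms(2) PQ(1)], rule compactin_diff_openin[OF assms(2) PQ(2)])
  moreover have "K - P \<subseteq> U" "K - Q \<subseteq> V" "K = (K - P) \<union> (K - Q)"
    using PQ by (auto simp: disjnt_def)
  ultimately show thesis using that by blast
qed

section \<open>The Riesz representation theorem\<close>

text \<open>The laws constrain \<open>I\<close> on \<open>ccont\<close> functions only. Since
  \<open>nonneg\<close> looks at values on the space alone, it also forces \<open>I\<close> to
  ignore values elsewhere, which is \<open>cong\<close>.\<close>

locale positive_functional =
  fixes X :: "'a topology" and I :: "('a \<Rightarrow> real) \<Rightarrow> real"
  assumes loc: "locally_compact_space X" and haus: "Hausdorff_space X"
    and add: "ccont X f \<Longrightarrow> ccont X g \<Longrightarrow> I (\<lambda>p. f p + g p) = I f + I g"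
    and scale: "ccont X f \<Longrightarrow> I (\<lambda>p. c * f p) = c * I f"
    and nonneg: "ccont X f \<Longrightarrow> (\<And>p. p \<in> topspace X \<Longrightarrow> 0 \<le> f p) \<Longrightarrow> 0 \<le> I f"
begin

lemma mono:
  assumes "ccont X f" "ccont X g" "\<And>p. p \<in> topspace X \<Longrightarrow> f p \<le> g p"
  shows "I f \<le> I g"
proof -
  have "0 \<le> I (\<lambda>p. g p + (-1) * f p)"
    by (intro nonneg ccont_add ccont_scale assms(1,2)) (use assms(3) in simp)
  also have "\<dots> = I g + (-1) * I f"
    by (simp only: add[OF assms(2) ccont_scale[OF assms(1)]] scale[OF assms(1)])
  finally show ?thesis by simp
qed

lemma cong:
  assumes "ccont X f" "ccont X g" "\<And>p. p \<in> topspace X \<Longrightarrow> f p = g p"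
  shows "I f = I g"
  using mono[of f g] mono[of g f] assms by force

lemma zero: "I (\<lambda>p. 0) = 0"
  using scale[OF ccont_zero, of 0] by simp

lemma sum: "finite S \<Longrightarrow> (\<And>k. k \<in> S \<Longrightarrow> ccont X (f k)) \<Longrightarrow> I (\<lambda>p. \<Sum>k\<in>S. f k p) = (\<Sum>k\<in>S. I (f k))"
  by (induction S rule: finite_induct) (auto simp: zero add ccont_sum)

text \<open>Cutting \<open>f\<close> into horizontal layers of height \<open>1/N\<close> determines \<open>I f\<close> up to \<open>m K / N\<close>.\<close>

lemma layer_bounds:
  fixes m :: "'a set \<Rightarrow> real" and N :: nat
  assumes upper: "\<And>g K. subord X K g \<Longrightarrow> compactin X K \<Longrightarrow> I g \<le> m K"
    and lower: "\<And>g K. ccont X g \<Longrightarrow> (\<And>p. p \<in> topspace X \<Longrightarrow> 0 \<le> g p) \<Longrightarrow>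
      compactin X K \<Longrightarrow> (\<And>p. p \<in> K \<Longrightarrow> 1 \<le> g p) \<Longrightarrow> m K \<le> I g"
    and f: "subord X K f" and K: "compactin X K" and N: "N > 0"
  defines "A \<equiv> \<lambda>k. if k = 0 then K else {p \<in> topspace X. real k / real N \<le> f p}"
  shows "(\<Sum>k<N. m (A (Suc k))) \<le> N * I f" and "N * I f \<le> (\<Sum>k<N. m (A k))"
proof -
  note fc = subord_ccont[OF f]
  \<comment> \<open>\<open>g k\<close> is \<open>N\<close> times the slice of \<open>f\<close>
    between heights \<open>k/N\<close> and \<open>(k+1)/N\<close>: it is \<open>1\<close> on
    \<open>A (Suc k)\<close>, \<open>0\<close> off \<open>A k\<close>, and the slices telescope to
    \<open>N * f\<close> because \<open>f\<close> is at most \<open>1\<close>. Height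
    \<open>0\<close> alone would give the whole space; \<open>A 0 = K\<close> is compact and still
    carries \<open>g 0\<close>.\<close>
  define g where "g k p = real N * min (f p) (real (Suc k) / N) - real N * min (f p) (k / N)" for k p
  have gc: "ccont X (g k)" for k
    unfolding g_def by (intro ccont_diff ccont_scale ccont_compose[OF fc, of "\<lambda>x. min x _"])
      (auto intro!: continuous_intros)
  have g01: "0 \<le> g k p \<and> g k p \<le> 1" for k p
    using N by (auto simp: g_def min_def field_simps)
  have Acl: "closedin X {p \<in> topspace X. f p \<in> {c..}}" for c
    by (rule closedin_continuous_map_preimage[OF ccont_cont[OF fc]]) auto
  have Ac: "compactin X (A k)" for k
  proof (cases "k = 0")
    case False
    have "A k \<subseteq> K" using False N subord_zero[OF f] by (force simp: A_def field_simps)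
    then show ?thesis using Acl[of "k / N"] closed_compactin[OF K, of "A k"] False by (simp add: A_def)
  qed (simp add: A_def K)
  have "subord X (A k) (g k)" for k
    unfolding subord_def
  proof (intro conjI exI[of _ "A k"] ballI Ac subset_refl)
    show "continuous_map X euclideanreal (g k)" using gc ccont_cont by blast
    show "g k p = 0" if "p \<in> topspace X - A k" for p
      using that subord_zero[OF f, of p] N by (auto simp: A_def g_def min_def field_simps split: if_splits)
  qed (use g01 in auto)
  then have up: "I (g k) \<le> m (A k)" for k using Ac upper by blast
  have lo: "m (A (Suc k)) \<le> I (g k)" for k
    by (rule lower[OF gc _ Ac]) (use g01 N in \<open>auto simp: A_def g_def min_def field_simps\<close>)
  have "(\<Sum>k<N. g k p) = N * f p" if "p \<in> topspace X" for p
  proof -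
    have "(\<Sum>k<n. g k p) = real N * min (f p) (n / N)" for n
      using subord_range[OF f that] by (induction n) (auto simp: g_def)
    from this[of N] show ?thesis using subord_range[OF f that] N by simp
  qed
  then have "I (\<lambda>p. \<Sum>k<N. g k p) = I (\<lambda>p. N * f p)"
    by (intro cong ccont_sum ccont_scale fc gc) auto
  then have "(\<Sum>k<N. I (g k)) = N * I f"
    by (simp add: sum[OF _ gc] scale[OF fc])
  then show "(\<Sum>k<N. m (A (Suc k))) \<le> N * I f" and "N * I f \<le> (\<Sum>k<N. m (A k))"
    using sum_mono[of "{..<N}" "\<lambda>k. m (A (Suc k))" "\<lambda>k. I (g k)"]
      sum_mono[of "{..<N}" "\<lambda>k. I (g k)" "\<lambda>k. m (A k)"] lo up by simp_all
qed

section \<open>From the functional to an outer measure\<close>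

definition content :: "'a set \<Rightarrow> ennreal"
  where "content U = (SUP f \<in> {f. subord X U f}. ennreal (I f))"

text \<open>\<open>content\<close> is the intended measure of open sets; extending it by an infimum
  over open supersets builds outer regularity into the construction.\<close>

definition outer :: "'a set \<Rightarrow> ennreal"
  where "outer A = (INF U \<in> {U. openin X U \<and> A \<subseteq> U}. content U)"

lemma content_upper: "subord X U f \<Longrightarrow> ennreal (I f) \<le> content U"
  unfolding content_def by (rule SUP_upper) simp

lemma content_mono: "U \<subseteq> V \<Longrightarrow> content U \<le> content V"
  unfolding content_def by (rule SUP_subset_mono) (auto intro: subord_mono)

lemma outer_lower: "openin X U \<Longrightarrow> A \<subseteq> U \<Longrightarrow> outer A \<le> content U"
  unfolding outer_def by (rule INF_lower) simp

lemma outer_open: "openin X U \<Longrightarrow> outer U = content U"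
  unfolding outer_def by (rule antisym) (auto intro!: INF_lower INF_greatest content_mono)

lemma outer_mono: "A \<subseteq> B \<Longrightarrow> outer A \<le> outer B"
  unfolding outer_def by (rule INF_superset_mono) auto

lemma outer_empty: "outer {} = 0"
proof -
  have "I f = 0" if "subord X {} f" for f
    using cong[OF subord_ccont[OF that] ccont_zero] subord_zero[OF that] zero by auto
  then show ?thesis
    using subord_zero_fun[of X "{}"] by (auto simp: outer_open content_def SUP_constant)
qed

text \<open>A compact carrier of \<open>f\<close> splits into \<open>L\<close> inside
  \<open>U\<close> and \<open>M\<close> inside \<open>V\<close>. Urysohn functions \<open>g\<close>
  and \<open>h\<close> equal to \<open>1\<close> on \<open>L\<close> and \<open>M\<close> give
  \<open>f \<le> g + h\<close>, and this domination does the work of a partition of unity.\<close>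

lemma content_Un:
  assumes "openin X U" "openin X V"
  shows "content (U \<union> V) \<le> content U + content V"
  unfolding content_def[of "U \<union> V"]
proof (rule SUP_least)
  fix f assume "f \<in> {f. subord X (U \<union> V) f}"
  then have f: "subord X (U \<union> V) f" by simp
  then obtain K where K: "compactin X K" "K \<subseteq> U \<union> V" "\<And>p. p \<in> topspace X \<Longrightarrow> p \<notin> K \<Longrightarrow> f p = 0"
    unfolding subord_def by blast
  obtain L M where LM: "compactin X L" "compactin X M" "L \<subseteq> U" "M \<subseteq> V" "K = L \<union> M"
    using compactin_Un_split[OF haus K(1) assms K(2)] by blast
  obtain g where g: "subord X U g" "\<And>p. p \<in> L \<Longrightarrow> g p = 1"
    using locally_compact_Urysohn[OF loc haus LM(1) assms(1) LM(3)] by blast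
  obtain h where h: "subord X V h" "\<And>p. p \<in> M \<Longrightarrow> h p = 1"
    using locally_compact_Urysohn[OF loc haus LM(2) assms(2) LM(4)] by blast
  note cc = subord_ccont[OF f] subord_ccont[OF g(1)] subord_ccont[OF h(1)]
  have "f p \<le> g p + h p" if "p \<in> topspace X" for p
    using subord_range[OF f that] subord_range[OF g(1) that] subord_range[OF h(1) that]
      g(2)[of p] h(2)[of p] K(3)[OF that] LM(5)
    by fastforce
  then have "I f \<le> I (\<lambda>p. g p + h p)" by (intro mono ccont_add cc) auto
  also have "\<dots> = I g + I h" by (rule add) (use cc in auto)
  finally have "ennreal (I f) \<le> ennreal (I g) + ennreal (I h)"
    using nonneg[OF cc(2)] nonneg[OF cc(3)] subord_range[OF g(1)] subord_range[OF h(1)]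
    by (metis ennreal_leI ennreal_plus)
  also have "\<dots> \<le> content U + content V"
    using g(1) h(1) by (intro add_mono content_upper)
  finally show "ennreal (I f) \<le> content U + content V" .
qed

text \<open>A function subordinate to the union has a compact carrier, which finitely many of the
  sets cover; so the finite case suffices for each function under the supremum.\<close>

lemma content_UN:
  fixes U :: "nat \<Rightarrow> 'a set"
  assumes "\<And>i. openin X (U i)"
  shows "content (\<Union>i. U i) \<le> (\<Sum>i. content (U i))"
  unfolding content_def[of "\<Union>i. U i"]
proof (rule SUP_least)
  fix f assume "f \<in> {f. subord X (\<Union>i. U i) f}"
  then have f: "subord X (\<Union>i. U i) f" by simp
  then obtain K where K: "compactin X K" "K \<subseteq> (\<Union>i. U i)" "\<And>p. p \<in> topspace X \<Longrightarrow> p \<notin> K \<Longrightarrow> f p = 0"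
    unfolding subord_def by blast
  have "\<exists>\<F>. finite \<F> \<and> \<F> \<subseteq> range U \<and> K \<subseteq> \<Union>\<F>"
    using K(1,2) assms unfolding compactin_def by auto
  then obtain J where J: "finite J" "K \<subseteq> (\<Union>i\<in>J. U i)"
    by (metis finite_subset_image)
  obtain n where n: "J \<subseteq> {..<n}" using finite_nat_bounded[OF J(1)] by blast
  have "subord X (\<Union>i<n. U i) f"
  proof -
    have "K \<subseteq> (\<Union>i<n. U i)" by (rule order_trans[OF J(2) UN_mono[OF n subset_refl]])
    then show ?thesis using f K(1,3) unfolding subord_def by (intro conjI exI[of _ K]) simp_all
  qed
  then have "ennreal (I f) \<le> content (\<Union>i<n. U i)" by (rule content_upper)
  also have "\<dots> \<le> (\<Sum>i<n. content (U i))"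
  proof (induction n)
    case 0
    then show ?case using outer_empty outer_open[of "{}"] by simp
  next
    case (Suc n)
    have "content (\<Union>i<Suc n. U i) \<le> content (\<Union>i<n. U i) + content (U n)"
      using content_Un[of "\<Union>i<n. U i" "U n"] assms by (auto simp: lessThan_Suc Un_commute)
    also have "\<dots> \<le> (\<Sum>i<Suc n. content (U i))" using Suc by (simp add: add_right_mono)
    finally show ?case .
  qed
  also have "\<dots> \<le> (\<Sum>i. content (U i))" by (rule sum_le_suminf) auto
  finally show "ennreal (I f) \<le> (\<Sum>i. content (U i))" .
qed

lemma outer_UN:
  fixes A :: "nat \<Rightarrow> 'a set"
  shows "outer (\<Union>i. A i) \<le> (\<Sum>i. outer (A i))"
proof (rule ennreal_le_epsilon)
  fix e :: real assume "0 < e" "(\<Sum>n. outer (A n)) < top"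
  then have fin: "outer (A n) \<noteq> \<infinity>" for n
    by (auto simp add: less_top dest!: ennreal_suminf_lessD)
  have "\<exists>U. openin X U \<and> A n \<subseteq> U \<and> content U \<le> outer (A n) + e * (1/2) ^ Suc n" for n
    using INF_approx_ennreal[OF _ outer_def[of "A n"] fin, of "e * (1/2) ^ Suc n"] \<open>0 < e\<close>
    by (auto intro: less_imp_le)
  then obtain U where U: "\<And>n. openin X (U n)" "\<And>n. A n \<subseteq> U n"
      "\<And>n. content (U n) \<le> outer (A n) + e * (1/2) ^ Suc n"
    by metis
  have "outer (\<Union>i. A i) \<le> content (\<Union>i. U i)" using U by (intro outer_lower) blast+
  also have "\<dots> \<le> (\<Sum>i. content (U i))" by (rule content_UN) (rule U)
  also have "\<dots> \<le> (\<Sum>n. outer (A n) + e * (1/2) ^ Suc n)"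
    by (intro suminf_le allI U) auto
  also have "\<dots> = (\<Sum>n. outer (A n)) + (\<Sum>n. ennreal e * ennreal ((1/2) ^ Suc n))"
    using \<open>0 < e\<close> by (subst suminf_add[symmetric])
      (auto simp del: ennreal_suminf_cmult simp add: ennreal_mult[symmetric])
  also have "\<dots> = (\<Sum>n. outer (A n)) + e"
    unfolding ennreal_suminf_cmult
    by (subst suminf_ennreal_eq[OF zero_le_power power_half_series]) auto
  finally show "outer (\<Union>i. A i) \<le> (\<Sum>n. outer (A n)) + e" .
qed

lemma outer_measure_space: "outer_measure_space (Pow (topspace X)) outer"
  unfolding outer_measure_space_def positive_def increasing_def countably_subadditive_def
  by (auto simp: outer_empty intro: outer_mono outer_UN)

text \<open>Let \<open>U\<close> be an open superset of \<open>A\<close>, and let \<open>f\<close>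
  be subordinate to the intersection of \<open>U\<close> and \<open>V\<close>, with carrier
  \<open>K\<close>. Any \<open>g\<close> subordinate to the open set \<open>U - K\<close> has a
  carrier disjoint from \<open>K\<close>, so \<open>f + g\<close> is again bounded by
  \<open>1\<close> and subordinate to \<open>U\<close>. Taking suprema over \<open>g\<close>, then
  over \<open>f\<close>, bounds the two pieces by \<open>content U\<close>, as \<open>U - K\<close>
  contains \<open>U - V\<close>.\<close>

lemma open_caratheodory:
  assumes V: "openin X V"
  shows "outer (A \<inter> V) + outer (A - V) \<le> outer A"
  unfolding outer_def[of A]
proof (rule INF_greatest)
  fix U assume "U \<in> {U. openin X U \<and> A \<subseteq> U}"
  then have U: "openin X U" "A \<subseteq> U" by auto
  have "ennreal (I f) + outer (U - V) \<le> content U" if f: "subord X (U \<inter> V) f" for f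
  proof -
    obtain K where K: "compactin X K" "K \<subseteq> U \<inter> V" "\<And>p. p \<in> topspace X \<Longrightarrow> p \<notin> K \<Longrightarrow> f p = 0"
      using f unfolding subord_def by (metis DiffI)
    have UK: "openin X (U - K)"
      by (intro openin_diff U compactin_imp_closedin haus K)
    have "ennreal (I f) + outer (U - V) \<le> ennreal (I f) + content (U - K)"
      using K(2) by (intro add_left_mono outer_lower UK) blast
    also have "\<dots> = (SUP g \<in> {g. subord X (U - K) g}. ennreal (I f) + ennreal (I g))"
      unfolding content_def by (rule ennreal_SUP_add_right) (use subord_zero_fun in blast)
    also have "\<dots> \<le> content U"
    proof (rule SUP_least)
      fix g assume "g \<in> {g. subord X (U - K) g}"
      then have g: "subord X (U - K) g" by simp
      obtain L where L: "compactin X L" "L \<subseteq> U - K" "\<And>p. p \<in> topspace X \<Longrightarrow> p \<notin> L \<Longrightarrow> g p = 0"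
        using g unfolding subord_def by blast
      note cc = subord_ccont[OF f] subord_ccont[OF g]
      have "subord X U (\<lambda>p. f p + g p)"
        unfolding subord_def
      proof (intro conjI exI[of _ "K \<union> L"] ballI)
        show "continuous_map X euclideanreal (\<lambda>p. f p + g p)"
          using ccont_add[OF cc] by (rule ccont_cont)
        fix p assume p: "p \<in> topspace X"
        show "0 \<le> f p + g p" "f p + g p \<le> 1"
          using subord_range[OF f p] subord_range[OF g p] K(3)[OF p] L(2) L(3)[OF p]
          by (cases "p \<in> K"; force)+
      qed (use K L compactin_Un in auto)
      then have "ennreal (I (\<lambda>p. f p + g p)) \<le> content U" by (rule content_upper)
      then show "ennreal (I f) + ennreal (I g) \<le> content U"
        using add[OF cc] nonneg[OF cc(1)] nonneg[OF cc(2)] subord_range[OF f] subord_range[OF g]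
        by simp
    qed
    finally show ?thesis .
  qed
  then have "(SUP f \<in> {f. subord X (U \<inter> V) f}. ennreal (I f) + outer (U - V)) \<le> content U"
    by (auto intro: SUP_least)
  then have "content (U \<inter> V) + outer (U - V) \<le> content U"
    unfolding content_def[of "U \<inter> V"]
    by (subst (asm) ennreal_SUP_add_left) (use subord_zero_fun in blast)+
  moreover have "outer (A \<inter> V) \<le> content (U \<inter> V)" "outer (A - V) \<le> outer (U - V)"
    using U V by (auto intro!: outer_lower outer_mono)
  ultimately show "outer (A \<inter> V) + outer (A - V) \<le> content U"
    by (meson add_mono order_trans)
qed

section \<open>The Borel measure and its regularity\<close>

definition riesz :: "'a measure"
  where "riesz = measure_of (topspace X) {U. openin X U} outer"

lemma opens_Pow: "{U. openin X U} \<subseteq> Pow (topspace X)"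
  using openin_subset by auto

lemma space_riesz: "space riesz = topspace X"
  and sets_riesz: "sets riesz = sigma_sets (topspace X) {U. openin X U}"
  unfolding riesz_def by (simp_all add: opens_Pow)

text \<open>\<open>measure_of\<close> gives the zero measure for a set function that is not a
  measure, so countable additivity of \<open>outer\<close> on Borel sets is what is at stake. By
  Caratheodory it holds on the lambda system, a sigma-algebra that contains the open sets by
  \<open>open_caratheodory\<close>.\<close>

lemma emeasure_riesz:
  assumes "A \<in> sets riesz"
  shows "emeasure riesz A = outer A"
proof -
  let ?\<Lambda> = "lambda_system (topspace X) (Pow (topspace X)) outer"
  have ms: "measure_space (topspace X) ?\<Lambda> outer"
    by (rule sigma_algebra.caratheodory_lemma[OF sigma_algebra_Pow outer_measure_space])
  have "V \<in> ?\<Lambda>" if V: "openin X V" for V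
  proof -
    have "outer A \<le> outer (A \<inter> V) + outer (A - V)" for A
    proof -
      \<comment> \<open>Padding the two pieces with empty sets turns countable subadditivity into
        subadditivity for two sets.\<close>
      let ?B = "\<lambda>i::nat. if i = 0 then A \<inter> V else if i = 1 then A - V else {}"
      have "(\<Union>i. ?B i) = A" by (auto split: if_splits)
      moreover have "(\<Sum>i. outer (?B i)) = (\<Sum>i\<in>{0,1}. outer (?B i))"
        by (rule suminf_finite) (auto simp: outer_empty)
      ultimately show ?thesis using outer_UN[of ?B] by simp
    qed
    then show ?thesis
      using open_caratheodory[OF V] openin_subset[OF V]
      by (auto simp: algebra.lambda_system_eq[OF algebra_Pow] intro: antisym)
  qed
  then have "sigma_sets (topspace X) {U. openin X U} \<subseteq> ?\<Lambda>"
    using ms unfolding measure_space_def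
    by (intro sigma_algebra.sigma_sets_subset) auto
  then have "measure_space (topspace X) (sigma_sets (topspace X) {U. openin X U}) outer"
    by (intro measure_down[OF ms] sigma_algebra_sigma_sets opens_Pow)
  then show ?thesis
    by (intro emeasure_measure_of[OF riesz_def opens_Pow _ _ assms])
      (auto simp: sets_riesz measure_space_def)
qed

lemma emeasure_riesz_open: "openin X U \<Longrightarrow> emeasure riesz U = content U"
  by (subst emeasure_riesz) (auto simp: sets_riesz outer_open intro: sigma_sets.Basic)

lemma compact_in_sets: "compactin X K \<Longrightarrow> K \<in> sets riesz"
proof -
  assume "compactin X K"
  then have "K \<subseteq> topspace X" "openin X (topspace X - K)"
    using haus compactin_imp_closedin closedin_subset by blast+
  then have "topspace X - (topspace X - K) \<in> sigma_sets (topspace X) {U. openin X U}"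
    by (intro sigma_sets.Compl sigma_sets.Basic) simp
  then show ?thesis using \<open>K \<subseteq> topspace X\<close> by (simp add: sets_riesz double_diff)
qed

text \<open>For \<open>c > 1\<close> the set \<open>K\<close> lies in the open set where
  \<open>g\<close> exceeds \<open>1/c\<close>, and every function subordinate to that set is at most
  \<open>c * g\<close>. Hence \<open>outer K\<close> is at most \<open>c * I g\<close>, and
  \<open>c\<close> tends to \<open>1\<close>.\<close>

lemma outer_le:
  assumes g: "ccont X g" "\<And>p. p \<in> topspace X \<Longrightarrow> 0 \<le> g p"
    and K: "K \<subseteq> topspace X" "\<And>p. p \<in> K \<Longrightarrow> 1 \<le> g p"
  shows "outer K \<le> ennreal (I g)"
proof -
  have "outer K \<le> ennreal (c * I g)" if c: "c > 1" for c
  proof -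
    let ?V = "{p \<in> topspace X. g p \<in> {1/c<..}}"
    have V: "openin X ?V"
      by (rule openin_continuous_map_preimage[OF ccont_cont[OF g(1)]]) auto
    have "1 / c < 1" using c by simp
    then have "K \<subseteq> ?V" using K by (auto intro: less_le_trans)
    then have "outer K \<le> content ?V" using V by (intro outer_lower)
    also have "\<dots> \<le> ennreal (c * I g)"
      unfolding content_def
    proof (rule SUP_least)
      fix h assume "h \<in> {h. subord X ?V h}"
      then have h: "subord X ?V h" by simp
      have "h p \<le> c * g p" if p: "p \<in> topspace X" for p
      proof (cases "p \<in> ?V")
        case True
        then have "1 \<le> c * g p" using c by (auto simp: field_simps)
        then show ?thesis using subord_range[OF h p] by linarith
      next
        case False
        then show ?thesis using subord_zero[OF h p] g(2)[OF p] c by simp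
      qed
      then have "I h \<le> I (\<lambda>p. c * g p)"
        by (intro mono subord_ccont[OF h] ccont_scale g(1))
      then show "ennreal (I h) \<le> ennreal (c * I g)"
        using scale[OF g(1)] by (simp add: ennreal_leI)
    qed
    finally show ?thesis .
  qed
  note * = this
  have nn: "0 \<le> I g" using nonneg g by blast
  show ?thesis
  proof (rule ennreal_le_epsilon)
    fix e :: real assume e: "e > 0"
    \<comment> \<open>With this factor the excess over \<open>I g\<close> is
      \<open>e * I g / (I g + 1)\<close>, which is at most \<open>e\<close>; the \<open>+ 1\<close>
      keeps the factor above \<open>1\<close> even when \<open>I g = 0\<close>.\<close>
    have "outer K \<le> ennreal ((1 + e / (I g + 1)) * I g)" using e nn by (intro *) simp
    also have "(1 + e / (I g + 1)) * I g \<le> I g + e"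
      using e nn by (simp add: field_simps)
    finally show "outer K \<le> ennreal (I g) + ennreal e" using e nn by (simp add: ennreal_leI)
  qed
qed

lemma outer_ge:
  assumes "subord X K g"
  shows "ennreal (I g) \<le> outer K"
  unfolding outer_def by (rule INF_greatest) (use assms subord_mono in \<open>blast intro: content_upper\<close>)

lemma emeasure_riesz_compact_finite:
  assumes K: "compactin X K"
  shows "emeasure riesz K < \<infinity>"
proof -
  obtain g where g: "subord X (topspace X) g" "\<And>p. p \<in> K \<Longrightarrow> g p = 1"
    using locally_compact_Urysohn[OF loc haus K openin_topspace compactin_subset_topspace[OF K]] by blast
  have "outer K \<le> ennreal (I g)"
    by (rule outer_le[OF subord_ccont[OF g(1)]])
      (use g subord_range[OF g(1)] compactin_subset_topspace[OF K] in auto)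
  then show ?thesis using compact_in_sets[OF K] by (simp add: emeasure_riesz order_le_less_trans)
qed

text \<open>Outer regularity is the definition of \<open>outer\<close>. For inner regularity of an
  open \<open>U\<close>, each \<open>f\<close> subordinate to \<open>U\<close> has a compact carrier
  \<open>K\<close> inside \<open>U\<close>, and \<open>I f\<close> is at most the measure of
  \<open>K\<close> by \<open>outer_ge\<close>.\<close>

lemma radon_riesz: "radon_measure X riesz"
  unfolding radon_measure_def
proof (intro conjI allI impI ballI)
  fix A assume A: "A \<in> sets riesz"
  show "emeasure riesz A = (INF U \<in> {U. openin X U \<and> A \<subseteq> U}. emeasure riesz U)"
    unfolding emeasure_riesz[OF A] outer_def by (rule INF_cong) (auto simp: emeasure_riesz_open)
next
  fix U assume U: "openin X U"
  show "emeasure riesz U = (SUP K \<in> {K. compactin X K \<and> K \<subseteq> U}. emeasure riesz K)"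
  proof (rule antisym)
    show "emeasure riesz U \<le> (SUP K \<in> {K. compactin X K \<and> K \<subseteq> U}. emeasure riesz K)"
      unfolding emeasure_riesz_open[OF U] content_def
    proof (rule SUP_least)
      fix f assume "f \<in> {f. subord X U f}"
      then have f: "subord X U f" by simp
      then obtain K where K: "compactin X K" "K \<subseteq> U" "\<And>p. p \<in> topspace X \<Longrightarrow> p \<notin> K \<Longrightarrow> f p = 0"
        unfolding subord_def by blast
      have "subord X K f" using f K unfolding subord_def by blast
      then have "ennreal (I f) \<le> emeasure riesz K"
        using outer_ge compact_in_sets[OF K(1)] by (simp add: emeasure_riesz)
      also have "\<dots> \<le> (SUP K \<in> {K. compactin X K \<and> K \<subseteq> U}. emeasure riesz K)"
        using K by (intro SUP_upper) simp
      finally show "ennreal (I f) \<le> (SUP K \<in> {K. compactin X K \<and> K \<subseteq> U}. emeasure riesz K)" .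
    qed
    show "(SUP K \<in> {K. compactin X K \<and> K \<subseteq> U}. emeasure riesz K) \<le> emeasure riesz U"
      using U by (intro SUP_least emeasure_mono) (auto simp: sets_riesz intro: sigma_sets.Basic)
  qed
qed (use space_riesz sets_riesz emeasure_riesz_compact_finite in auto)

end

section \<open>Integration against Radon measures and uniqueness\<close>

lemma radon_open_sets: "radon_measure X M \<Longrightarrow> openin X U \<Longrightarrow> U \<in> sets M"
  unfolding radon_measure_def by (auto intro: sigma_sets.Basic)

lemma radon_space: "radon_measure X M \<Longrightarrow> space M = topspace X"
  unfolding radon_measure_def by blast

lemma radon_closed_sets:
  assumes "radon_measure X M" "closedin X C"
  shows "C \<in> sets M"
proof -
  have "space M - (topspace X - C) \<in> sets M"
    using assms by (intro sets.compl_sets radon_open_sets[OF assms(1)]) blast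
  then show ?thesis
    using closedin_subset[OF assms(2)] by (simp add: radon_space[OF assms(1)] double_diff)
qed

lemma radon_compact_sets:
  "radon_measure X M \<Longrightarrow> Hausdorff_space X \<Longrightarrow> compactin X K \<Longrightarrow> K \<in> sets M"
  by (intro radon_closed_sets compactin_imp_closedin)

lemma radon_compact_finite: "radon_measure X M \<Longrightarrow> compactin X K \<Longrightarrow> emeasure M K < \<infinity>"
  unfolding radon_measure_def by blast

lemma radon_borel_measurable:
  fixes f :: "'a \<Rightarrow> 'b :: topological_space"
  assumes "radon_measure X M" "continuous_map X euclidean f"
  shows "f \<in> borel_measurable M"
proof (rule borel_measurableI)
  fix S :: "'b set" assume "open S"
  then have "openin X {p \<in> topspace X. f p \<in> S}"
    by (intro openin_continuous_map_preimage[OF assms(2)]) simp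
  moreover have "f -` S \<inter> space M = {p \<in> topspace X. f p \<in> S}"
    using radon_space[OF assms(1)] by auto
  ultimately show "f -` S \<inter> space M \<in> sets M"
    using radon_open_sets[OF assms(1)] by simp
qed

lemma radon_integrable:
  fixes f :: "'a \<Rightarrow> 'b :: {banach, second_countable_topology}"
  assumes M: "radon_measure X M" and H: "Hausdorff_space X" and f: "ccont X f"
  shows "integrable M f"
proof -
  obtain K where K: "compactin X K" "\<And>p. p \<in> topspace X \<Longrightarrow> p \<notin> K \<Longrightarrow> f p = 0"
    using f by (rule ccontE) blast
  have "compact (f ` K)"
    using image_compactin[OF K(1) ccont_cont[OF f]] by simp
  then obtain B where B: "\<And>p. p \<in> K \<Longrightarrow> norm (f p) \<le> B"
    using compact_imp_bounded bounded_iff by (metis imageI)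
  show ?thesis
    by (rule integrableI_bounded_set[where A = K and B = B])
      (use B K radon_compact_sets[OF M H] radon_compact_finite[OF M]
        radon_borel_measurable[OF M ccont_cont[OF f]] radon_space[OF M] in auto)
qed

text \<open>Together with \<open>radon_integral_lower\<close> this is the pair of comparisons that
  \<open>layer_bounds\<close> asks of a functional, here integration against \<open>M\<close> with
  \<open>m = measure M\<close>.\<close>

lemma radon_integral_upper:
  fixes M :: "'a measure"
  assumes M: "radon_measure X M" and H: "Hausdorff_space X"
    and g: "subord X K g" and K: "compactin X K"
  shows "(LINT p|M. g p) \<le> measure M K"
proof -
  have i: "integrable M (indicator K :: 'a \<Rightarrow> real)"
    using radon_compact_sets[OF M H K] radon_compact_finite[OF M K] by (simp add: integrable_indicator_iff)
  have "(LINT p|M. g p) \<le> (LINT p|M. indicator K p)"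
    by (intro integral_mono radon_integrable[OF M H] subord_ccont[OF g] i)
      (use subord_range[OF g] subord_zero[OF g] radon_space[OF M] in \<open>auto simp: indicator_def\<close>)
  also have "\<dots> = measure M K"
    using radon_compact_sets[OF M H K] by simp
  finally show ?thesis .
qed

lemma radon_integral_lower:
  fixes M :: "'a measure"
  assumes M: "radon_measure X M" and H: "Hausdorff_space X"
    and g: "ccont X g" "\<And>p. p \<in> topspace X \<Longrightarrow> 0 \<le> g p"
    and K: "compactin X K" "\<And>p. p \<in> K \<Longrightarrow> 1 \<le> g p"
  shows "measure M K \<le> (LINT p|M. g p)"
proof -
  have i: "integrable M (indicator K :: 'a \<Rightarrow> real)"
    using radon_compact_sets[OF M H K(1)] radon_compact_finite[OF M K(1)] by (simp add: integrable_indicator_iff)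
  have "measure M K = (LINT p|M. indicator K p)"
    using radon_compact_sets[OF M H K(1)] by simp
  also have "\<dots> \<le> (LINT p|M. g p)"
    by (intro integral_mono radon_integrable[OF M H] g i)
      (use g K radon_space[OF M] in \<open>auto simp: indicator_def\<close>)
  finally show ?thesis .
qed

text \<open>By inner regularity only compact \<open>K\<close> inside \<open>U\<close> matter. A
  Urysohn function that is \<open>1\<close> on \<open>K\<close> and has compact carrier
  \<open>C\<close> inside \<open>U\<close> has an integral between the \<open>M\<close>-measure of
  \<open>K\<close> and the \<open>N\<close>-measure of \<open>C\<close>.\<close>

lemma radon_open_le:
  assumes M: "radon_measure X M" and N: "radon_measure X N"
    and H: "Hausdorff_space X" and L: "locally_compact_space X"
    and eq: "\<And>f :: 'a \<Rightarrow> real. ccont X f \<Longrightarrow> (LINT p|M. f p) = (LINT p|N. f p)"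
    and U: "openin X U"
  shows "emeasure M U \<le> emeasure N U"
proof -
  have "emeasure M K \<le> emeasure N U" if K: "compactin X K" "K \<subseteq> U" for K
  proof -
    obtain f where f: "subord X U f" "\<And>p. p \<in> K \<Longrightarrow> f p = 1"
      using locally_compact_Urysohn[OF L H K(1) U K(2)] by blast
    obtain C where C: "compactin X C" "C \<subseteq> U" "subord X C f"
      using f(1) unfolding subord_def by blast
    have "measure M K \<le> (LINT p|M. f p)"
      by (rule radon_integral_lower[OF M H subord_ccont[OF f(1)] _ K(1)])
        (use f subord_range[OF f(1)] in auto)
    also have "\<dots> \<le> measure N C"
      using eq[OF subord_ccont[OF f(1)]] radon_integral_upper[OF N H C(3,1)] by simp
    finally have "emeasure M K \<le> emeasure N C"
      using radon_compact_finite[OF M K(1)] radon_compact_finite[OF N C(1)]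
      by (metis emeasure_eq_ennreal_measure ennreal_leI infinity_ennreal_def less_irrefl)
    also have "\<dots> \<le> emeasure N U"
      by (intro emeasure_mono C radon_open_sets[OF N U])
    finally show ?thesis .
  qed
  moreover have "emeasure M U = (SUP K \<in> {K. compactin X K \<and> K \<subseteq> U}. emeasure M K)"
    using M U unfolding radon_measure_def by blast
  ultimately show ?thesis by (auto intro: SUP_least)
qed

text \<open>Outer regularity reduces equality on Borel sets to open sets, where
  \<open>radon_open_le\<close> applies in both directions.\<close>

lemma radon_measure_eqI:
  assumes M: "radon_measure X M" and N: "radon_measure X N"
    and H: "Hausdorff_space X" and L: "locally_compact_space X"
    and eq: "\<And>f :: 'a \<Rightarrow> real. ccont X f \<Longrightarrow> (LINT p|M. f p) = (LINT p|N. f p)"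
  shows "M = N"
proof (rule measure_eqI)
  show s: "sets M = sets N" using M N unfolding radon_measure_def by simp
  fix A assume A: "A \<in> sets M"
  have "emeasure M U = emeasure N U" if "openin X U" for U
    using radon_open_le[OF M N H L eq that] radon_open_le[OF N M H L eq[symmetric] that] by (rule antisym)
  moreover have "emeasure M A = (INF U \<in> {U. openin X U \<and> A \<subseteq> U}. emeasure M U)"
    using A M unfolding radon_measure_def by blast
  moreover have "emeasure N A = (INF U \<in> {U. openin X U \<and> A \<subseteq> U}. emeasure N U)"
    using A N s unfolding radon_measure_def by blast
  ultimately show "emeasure M A = emeasure N A" by (auto intro: INF_cong)
qed

lemma positive_functional_integral:
  assumes M: "radon_measure X M" and H: "Hausdorff_space X" and L: "locally_compact_space X"
  shows "positive_functional X (\<lambda>f. LINT p|M. f p)"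
proof
  fix f g :: "'a \<Rightarrow> real" assume "ccont X f" "ccont X g"
  then show "(LINT p|M. f p + g p) = (LINT p|M. f p) + (LINT p|M. g p)"
    by (intro Bochner_Integration.integral_add radon_integrable[OF M H])
next
  fix f :: "'a \<Rightarrow> real" assume "\<And>p. p \<in> topspace X \<Longrightarrow> 0 \<le> f p"
  then show "0 \<le> (LINT p|M. f p)"
    using radon_space[OF M] by (intro integral_nonneg_AE) auto
qed (use H L in auto)

section \<open>The functional as an integral\<close>

context positive_functional
begin

text \<open>\<open>layer_bounds\<close> applies to \<open>I\<close> and to integration against
  \<open>riesz\<close> with the same \<open>m\<close>, so \<open>N\<close> times either value lies
  between the same two layer sums. Their difference telescopes to at most the measure of
  \<open>K\<close>; dividing by \<open>N\<close> and letting \<open>N\<close> grow gives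
  equality.\<close>

lemma integral_riesz_subord:
  assumes f: "subord X K f" and K: "compactin X K"
  shows "(LINT p|riesz. f p) = I f"
proof -
  interpret J: positive_functional X "\<lambda>f. LINT p|riesz. f p"
    by (rule positive_functional_integral[OF radon_riesz haus loc])
  have fin: "emeasure riesz K = measure riesz K" if "compactin X K" for K
    using emeasure_riesz_compact_finite[OF that] by (intro emeasure_eq_ennreal_measure) simp
  have upper: "I g \<le> measure riesz K" if "subord X K g" "compactin X K" for g K
    using outer_ge[OF that(1)] emeasure_riesz[OF compact_in_sets[OF that(2)]] fin[OF that(2)]
    by (metis ennreal_le_iff measure_nonneg)
  have lower: "measure riesz K \<le> I g"
    if "ccont X g" "\<And>p. p \<in> topspace X \<Longrightarrow> 0 \<le> g p" "compactin X K" "\<And>p. p \<in> K \<Longrightarrow> 1 \<le> g p" for g K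
    using outer_le[OF that(1,2) compactin_subset_topspace[OF that(3)] that(4)]
      emeasure_riesz[OF compact_in_sets[OF that(3)]] fin[OF that(3)] nonneg[OF that(1,2)]
    by (metis ennreal_le_iff)
  have upperJ: "(LINT p|riesz. g p) \<le> measure riesz K" if "subord X K g" "compactin X K" for g K
    by (rule radon_integral_upper[OF radon_riesz haus that])
  have lowerJ: "measure riesz K \<le> (LINT p|riesz. g p)"
    if "ccont X g" "\<And>p. p \<in> topspace X \<Longrightarrow> 0 \<le> g p" "compactin X K" "\<And>p. p \<in> K \<Longrightarrow> 1 \<le> g p" for g K
    by (rule radon_integral_lower[OF radon_riesz haus that])
  have "\<bar>I f - (LINT p|riesz. f p)\<bar> \<le> measure riesz K / N" if N: "N > 0" for N :: nat
  proof -
    define A where "A k = (if k = 0 then K else {p \<in> topspace X. real k / real N \<le> f p})" for k :: nat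
    have bounds:
      "(\<Sum>k<N. measure riesz (A (Suc k))) \<le> N * I f"
      "N * I f \<le> (\<Sum>k<N. measure riesz (A k))"
      "(\<Sum>k<N. measure riesz (A (Suc k))) \<le> N * (LINT p|riesz. f p)"
      "N * (LINT p|riesz. f p) \<le> (\<Sum>k<N. measure riesz (A k))"
      unfolding A_def
      subgoal by (rule layer_bounds(1)[where m = "measure riesz"]) fact+
      subgoal by (rule layer_bounds(2)[where m = "measure riesz"]) fact+
      subgoal by (rule J.layer_bounds(1)[where m = "measure riesz"]) fact+
      subgoal by (rule J.layer_bounds(2)[where m = "measure riesz"]) fact+
      done
    have "(\<Sum>k<N. measure riesz (A k)) - (\<Sum>k<N. measure riesz (A (Suc k)))
        = measure riesz (A 0) - measure riesz (A N)"
      using sum_lessThan_telescope'[of "\<lambda>k. measure riesz (A k)" N] by (simp only: sum_subtractf)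
    also have "\<dots> \<le> measure riesz K" by (simp add: A_def)
    finally have "\<bar>real N * I f - N * (LINT p|riesz. f p)\<bar> \<le> measure riesz K"
      using bounds by linarith
    then have "real N * \<bar>I f - (LINT p|riesz. f p)\<bar> \<le> measure riesz K"
      by (simp add: right_diff_distrib[symmetric] abs_mult)
    then show ?thesis using N by (simp add: field_simps)
  qed
  moreover have "(\<lambda>N. measure riesz K / real N) \<longlonglongrightarrow> 0"
    by (rule lim_const_over_n)
  ultimately have "\<bar>I f - (LINT p|riesz. f p)\<bar> \<le> 0"
    by (intro LIMSEQ_le_const) (auto intro!: exI[of _ 1])
  then show ?thesis by simp
qed

lemma integral_riesz_nonneg:
  assumes f: "ccont X f" "\<And>p. p \<in> topspace X \<Longrightarrow> 0 \<le> f p"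
  shows "(LINT p|riesz. f p) = I f"
proof -
  obtain K where K: "compactin X K" "\<And>p. p \<in> topspace X \<Longrightarrow> p \<notin> K \<Longrightarrow> f p = 0"
    using f(1) by (rule ccontE) blast
  have "compact (f ` K)"
    using image_compactin[OF K(1) ccont_cont[OF f(1)]] by simp
  then obtain B where B: "B > 0" "\<And>p. p \<in> K \<Longrightarrow> \<bar>f p\<bar> \<le> B"
    using compact_imp_bounded bounded_pos by (metis imageI real_norm_def)
  have "subord X K (\<lambda>p. inverse B * f p)"
    unfolding subord_def
  proof (intro conjI exI[of _ K] ballI K(1) subset_refl)
    show "continuous_map X euclideanreal (\<lambda>p. inverse B * f p)"
      using ccont_cont[OF ccont_scale[OF f(1)]] .
    fix p assume p: "p \<in> topspace X"
    have "f p \<le> B" using B K(2)[OF p] by (cases "p \<in> K") force+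
    then show "0 \<le> inverse B * f p" "inverse B * f p \<le> 1"
      using f(2)[OF p] B(1) by (auto simp: field_simps)
  qed (use K in auto)
  then have "(LINT p|riesz. inverse B * f p) = I (\<lambda>p. inverse B * f p)"
    using K(1) by (rule integral_riesz_subord)
  then show ?thesis using B(1) scale[OF f(1)] by simp
qed

theorem integral_riesz:
  assumes f: "ccont X f"
  shows "(LINT p|riesz. f p) = I f"
proof -
  have c: "ccont X (\<lambda>p. max 0 (f p))" "ccont X (\<lambda>p. max 0 (- f p))"
    by (rule ccont_compose[OF f]; auto intro!: continuous_intros)+
  have eq: "f p = max 0 (f p) - max 0 (- f p)" for p by simp
  have "(LINT p|riesz. f p) = (LINT p|riesz. max 0 (f p)) - (LINT p|riesz. max 0 (- f p))"
    by (subst eq, rule Bochner_Integration.integral_diff) (intro radon_integrable[OF radon_riesz haus] c)+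
  also have "\<dots> = I (\<lambda>p. max 0 (f p)) - I (\<lambda>p. max 0 (- f p))"
    using c by (simp add: integral_riesz_nonneg)
  also have "\<dots> = I (\<lambda>p. max 0 (f p)) + I (\<lambda>p. (-1) * max 0 (- f p))"
    using scale[OF c(2), of "-1"] by simp
  also have "\<dots> = I (\<lambda>p. max 0 (f p) + (-1) * max 0 (- f p))"
    by (rule add[symmetric]) (intro c ccont_scale)+
  also have "\<dots> = I f"
    by (intro cong f ccont_add ccont_scale c) auto
  finally show ?thesis .
qed

end

section \<open>Sums over the fibres of a local homeomorphism\<close>

lemma continuous_map_locally:
  assumes "\<And>x. x \<in> topspace X \<Longrightarrow>
    \<exists>N. openin X N \<and> x \<in> N \<and> continuous_map (subtopology X N) Y f"
  shows "continuous_map X Y f"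
proof -
  obtain N where N: "\<And>x. x \<in> topspace X \<Longrightarrow> openin X (N x)" "\<And>x. x \<in> topspace X \<Longrightarrow> x \<in> N x"
      "\<And>x. x \<in> topspace X \<Longrightarrow> continuous_map (subtopology X (N x)) Y f"
    using assms by metis
  show ?thesis
    by (rule pasting_lemma[where I = "topspace X" and T = N and f = "\<lambda>_. f"]) (use N in auto)
qed

text \<open>The sheet, its image and the section are named because later functions are written with
  the section itself: fibre sums, inverse charts and extended translates.\<close>

definition local_inverse ::
    "'a topology \<Rightarrow> 'b topology \<Rightarrow> ('a \<Rightarrow> 'b) \<Rightarrow> 'a set \<Rightarrow> 'b set \<Rightarrow> ('b \<Rightarrow> 'a) \<Rightarrow> bool"
  where "local_inverse X Y f U V s \<longleftrightarrow> openin X U \<and> openin Y V \<and>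
    (\<forall>q\<in>U. f q \<in> V \<and> s (f q) = q) \<and> (\<forall>y\<in>V. s y \<in> U \<and> f (s y) = y) \<and>
    continuous_map (subtopology Y V) X s"

lemma local_homeomorphism_imp_local_inverse:
  assumes "local_homeomorphism X Y f" "p \<in> topspace X"
  obtains U V s where "local_inverse X Y f U V s" "p \<in> U"
proof -
  obtain U V where UV: "openin X U" "p \<in> U" "openin Y V"
      "homeomorphic_map (subtopology X U) (subtopology Y V) f"
    using assms unfolding local_homeomorphism_def by blast
  then obtain s where s: "homeomorphic_maps (subtopology X U) (subtopology Y V) f s"
    using homeomorphic_map_maps by blast
  have ts: "topspace (subtopology X U) = U" "topspace (subtopology Y V) = V"
    using UV(1,3) by (simp_all add: openin_subset Int_absorb1)
  have "local_inverse X Y f U V s"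
    using s UV(1,3) unfolding local_inverse_def homeomorphic_maps_def continuous_map_in_subtopology ts
    by auto
  then show thesis using that UV(2) by blast
qed

lemma local_inverse_restrict:
  assumes "local_inverse X Y f U V s" "openin X W"
  shows "local_inverse X Y f (U \<inter> W) {y \<in> V. s y \<in> W} s"
proof -
  have s: "continuous_map (subtopology Y V) X s" and V: "openin Y V" and U: "openin X U"
    using assms(1) by (auto simp: local_inverse_def)
  have "topspace (subtopology Y V) = V" using V by (simp add: openin_subset Int_absorb1)
  then have "openin (subtopology Y V) {y \<in> V. s y \<in> W}"
    using openin_continuous_map_preimage[OF s assms(2)] by simp
  then have "openin Y {y \<in> V. s y \<in> W}" using V openin_open_subtopology by blast
  moreover have "continuous_map (subtopology Y {y \<in> V. s y \<in> W}) X s"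
    by (rule continuous_map_from_subtopology_mono[OF s]) auto
  ultimately show ?thesis
    using assms U by (auto simp: local_inverse_def)
qed

lemma Hausdorff_finite_disjoint:
  assumes "Hausdorff_space X" "finite F" "F \<subseteq> topspace X"
  obtains W where "\<And>e. e \<in> F \<Longrightarrow> openin X (W e) \<and> e \<in> W e"
    "\<And>e e'. e \<in> F \<Longrightarrow> e' \<in> F \<Longrightarrow> e \<noteq> e' \<Longrightarrow> W e \<inter> W e' = {}"
proof -
  have "\<forall>e\<in>F. \<forall>e'\<in>F. e \<noteq> e' \<longrightarrow> (\<exists>P Q. openin X P \<and> openin X Q \<and> e \<in> P \<and> e' \<in> Q \<and> disjnt P Q)"
    using assms(1,3) unfolding Hausdorff_space_def by blast
  then obtain P Q where PQ: "\<And>e e'. e \<in> F \<Longrightarrow> e' \<in> F \<Longrightarrow> e \<noteq> e' \<Longrightarrow>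
      openin X (P e e') \<and> openin X (Q e e') \<and> e \<in> P e e' \<and> e' \<in> Q e e' \<and> P e e' \<inter> Q e e' = {}"
    unfolding disjnt_def by metis
  \<comment> \<open>An ordered pair of points chooses its own separating sets, so \<open>W e\<close>
    is cut down by both orders; then \<open>W e\<close> lies in \<open>P e e'\<close> and
    \<open>W e'\<close> in \<open>Q e e'\<close>. Intersecting with the whole space handles the case
    of a single point, where the intersection over the empty family is everything.\<close>
  define W where "W e = topspace X \<inter> \<Inter>((\<lambda>e'. P e e' \<inter> Q e' e) ` (F - {e}))" for e
  have "openin X (W e) \<and> e \<in> W e" if "e \<in> F" for e
  proof
    show "openin X (W e)"
    proof (cases "F - {e} = {}")
      case False
      then show ?thesis
        unfolding W_def using PQ that assms(2)
        by (intro openin_Int openin_topspace openin_Inter) auto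
    next
      case True
      then show ?thesis unfolding W_def True by simp
    qed
    show "e \<in> W e"
      using PQ that assms(3) by (auto simp: W_def)
  qed
  moreover have "W e \<inter> W e' = {}" if "e \<in> F" "e' \<in> F" "e \<noteq> e'" for e e'
  proof -
    have "W e \<subseteq> P e e'" "W e' \<subseteq> Q e e'" using that by (auto simp: W_def)
    then show ?thesis using PQ[OF that] by blast
  qed
  ultimately show thesis by (rule that)
qed

definition fibre_sum :: "'a topology \<Rightarrow> ('a \<Rightarrow> 'b) \<Rightarrow> ('a \<Rightarrow> 'c::real_normed_vector) \<Rightarrow> 'b \<Rightarrow> 'c"
  where "fibre_sum X p f y = (\<Sum>\<^sub>\<infinity>e \<in> {e \<in> topspace X. p e = y}. f e)"

context
  fixes X :: "'a topology" and Y :: "'b topology" and p :: "'a \<Rightarrow> 'b"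
  assumes HX: "Hausdorff_space X" and HY: "Hausdorff_space Y" and cp: "continuous_map X Y p"
    and li: "\<And>e. e \<in> topspace X \<Longrightarrow> \<exists>U V s. local_inverse X Y p U V s \<and> e \<in> U"
begin

text \<open>The fibre over \<open>y\<close> is closed, so its part in \<open>K\<close> is compact.
  Each of its points has an open neighbourhood on which \<open>p\<close> is injective and which
  therefore contains no other point of the fibre; a finite subcover lists them all.\<close>

lemma finite_fibre_Int_compact:
  assumes K: "compactin X K" and y: "y \<in> topspace Y"
  shows "finite {e \<in> K. p e = y}"
proof -
  have "closedin X {e \<in> topspace X. p e \<in> {y}}"
    using cp y HY by (intro closedin_continuous_map_preimage) (auto simp: closedin_Hausdorff_singleton)
  then have "compactin X ({e \<in> topspace X. p e \<in> {y}} \<inter> K)"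
    by (rule closed_Int_compactin[OF _ K])
  moreover have "{e \<in> topspace X. p e \<in> {y}} \<inter> K = {e \<in> K. p e = y}"
    using compactin_subset_topspace[OF K] by auto
  ultimately have c: "compactin X {e \<in> K. p e = y}" by simp
  obtain U where U: "\<And>e. e \<in> topspace X \<Longrightarrow> openin X (U e) \<and> e \<in> U e \<and> inj_on p (U e)"
    using li unfolding local_inverse_def by (metis inj_onI)
  have "\<exists>\<F>. finite \<F> \<and> \<F> \<subseteq> U ` {e \<in> K. p e = y} \<and> {e \<in> K. p e = y} \<subseteq> \<Union>\<F>"
    using c U compactin_subset_topspace[OF K] unfolding compactin_def
    by (elim conjE allE[of _ "U ` {e \<in> K. p e = y}"] impE) blast+
  then obtain J where J: "finite J" "J \<subseteq> {e \<in> K. p e = y}" "{e \<in> K. p e = y} \<subseteq> (\<Union>e\<in>J. U e)"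
    by (metis (no_types, lifting) finite_subset_image)
  have "{e \<in> K. p e = y} \<subseteq> J"
  proof
    fix e assume e: "e \<in> {e \<in> K. p e = y}"
    then obtain e' where e': "e' \<in> J" "e \<in> U e'" using J by blast
    then have "e = e'"
      using U[of e'] e J(2) compactin_subset_topspace[OF K] by (auto dest!: inj_onD)
    then show "e \<in> J" using e' by simp
  qed
  then show ?thesis using J(1) finite_subset by blast
qed

lemma fibre_support:
  fixes f :: "'a \<Rightarrow> 'c::real_normed_vector"
  assumes "ccont X f" "y \<in> topspace Y"
  shows "finite {e \<in> topspace X. p e = y \<and> f e \<noteq> 0}"
proof -
  obtain K where K: "compactin X K" "\<And>e. e \<in> topspace X \<Longrightarrow> e \<notin> K \<Longrightarrow> f e = 0"
    using assms(1) by (rule ccontE) blast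
  show ?thesis
    by (rule finite_subset[OF _ finite_fibre_Int_compact[OF K(1) assms(2)]]) (use K in auto)
qed

lemma summable_on_fibre:
  fixes f :: "'a \<Rightarrow> 'c::real_normed_vector"
  assumes "ccont X f" "y \<in> topspace Y"
  shows "f summable_on {e \<in> topspace X. p e = y}"
proof -
  have "f summable_on {e \<in> topspace X. p e = y \<and> f e \<noteq> 0}"
    using fibre_support[OF assms] by simp
  then show ?thesis by (rule summable_on_cong_neutral[THEN iffD1, rotated -1]) auto
qed

theorem ccont_fibre_sum:
  fixes f :: "'a \<Rightarrow> 'c::real_normed_vector"
  assumes f: "ccont X f"
  shows "ccont Y (fibre_sum X p f)"
proof -
  obtain K where K: "compactin X K" "\<And>e. e \<in> topspace X \<Longrightarrow> e \<notin> K \<Longrightarrow> f e = 0"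
    using f by (rule ccontE) blast
  note Ks = compactin_subset_topspace[OF K(1)]
  have "\<exists>N. openin Y N \<and> y \<in> N \<and> continuous_map (subtopology Y N) euclidean (fibre_sum X p f)"
    if y: "y \<in> topspace Y" for y
  proof -
    define F where "F = {e \<in> K. p e = y}"
    have F: "finite F" "F \<subseteq> topspace X"
      using finite_fibre_Int_compact[OF K(1) y] Ks by (auto simp: F_def)
    obtain W where W: "\<And>e. e \<in> F \<Longrightarrow> openin X (W e) \<and> e \<in> W e"
        "\<And>e e'. e \<in> F \<Longrightarrow> e' \<in> F \<Longrightarrow> e \<noteq> e' \<Longrightarrow> W e \<inter> W e' = {}"
      using Hausdorff_finite_disjoint[OF HX F] by blast
    have "\<exists>U V s. local_inverse X Y p U V s \<and> e \<in> U \<and> U \<subseteq> W e" if "e \<in> F" for e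
    proof -
      obtain U V s where "local_inverse X Y p U V s" "e \<in> U"
        using li[OF subsetD[OF F(2) \<open>e \<in> F\<close>]] by blast
      then show ?thesis using local_inverse_restrict[of X Y p U V s "W e"] W(1)[OF that] by blast
    qed
    then obtain U V s where UVs: "\<And>e. e \<in> F \<Longrightarrow> local_inverse X Y p (U e) (V e) (s e)"
        "\<And>e. e \<in> F \<Longrightarrow> e \<in> U e" "\<And>e. e \<in> F \<Longrightarrow> U e \<subseteq> W e"
      by metis
    have U: "openin X (U e)" and V: "openin Y (V e)" if "e \<in> F" for e
      using UVs(1)[OF that] by (auto simp: local_inverse_def)
    have sU: "s e z \<in> U e" "p (s e z) = z" if "e \<in> F" "z \<in> V e" for e z
      using UVs(1)[OF that(1)] that(2) by (auto simp: local_inverse_def)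
    have ps: "s e (p q) = q" if "e \<in> F" "q \<in> U e" for e q
      using UVs(1)[OF that(1)] that(2) by (auto simp: local_inverse_def)
    \<comment> \<open>\<open>C\<close> is the set of \<open>z\<close> over which \<open>K\<close>
      has a point outside all chosen sheets. It is compact, hence closed, and misses
      \<open>y\<close>, so removing it leaves a neighbourhood of \<open>y\<close>.\<close>
    define C where "C = p ` (K - (\<Union>e\<in>F. U e))"
    have "compactin Y C"
      unfolding C_def using U by (intro image_compactin[OF _ cp] compactin_diff_openin K) blast
    then have C: "closedin Y C" by (rule compactin_imp_closedin[OF HY])
    define N where "N = (topspace Y \<inter> \<Inter>(V ` F)) - C"
    have "openin Y (topspace Y \<inter> \<Inter>(V ` F))"
      using V F(1) by (cases "F = {}") (auto intro!: openin_Int openin_Inter)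
    then have N: "openin Y N" unfolding N_def using C by (intro openin_diff)
    have "p e \<in> V e" if "e \<in> F" for e
      using UVs(1,2)[OF that] by (auto simp: local_inverse_def)
    then have yN: "y \<in> N"
      using y UVs(2) by (auto simp: N_def C_def F_def)
    have eq: "fibre_sum X p f z = (\<Sum>e\<in>F. f (s e z))" if z: "z \<in> N" for z
    proof -
      have zV: "z \<in> V e" if "e \<in> F" for e using z that by (auto simp: N_def)
      have inj: "inj_on (\<lambda>e. s e z) F"
      proof (rule inj_onI, rule ccontr)
        fix e e' assume *: "e \<in> F" "e' \<in> F" "s e z = s e' z" "e \<noteq> e'"
        then show False
          using sU(1)[OF *(1) zV] sU(1)[OF *(2) zV] UVs(3)[OF *(1)] UVs(3)[OF *(2)] W(2)[OF *(1,2,4)] *(3) by auto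
      qed
      have "fibre_sum X p f z = infsum f ((\<lambda>e. s e z) ` F)"
        unfolding fibre_sum_def
      proof (rule infsum_cong_neutral)
        fix e assume "e \<in> {e \<in> topspace X. p e = z} - (\<lambda>e. s e z) ` F"
        then have e: "e \<in> topspace X" "p e = z" "e \<notin> (\<lambda>e. s e z) ` F" by auto
        have "e \<notin> K"
        proof
          assume "e \<in> K"
          then obtain e' where "e' \<in> F" "e \<in> U e'"
            using z e(2) by (auto simp: N_def C_def)
          then show False using ps[of e' e] e by auto
        qed
        then show "f e = 0" using K(2) e by blast
      next
        fix e assume "e \<in> (\<lambda>e. s e z) ` F - {e \<in> topspace X. p e = z}"
        then obtain e' where e': "e' \<in> F" "e = s e' z" "\<not> (e \<in> topspace X \<and> p e = z)" by auto
        then show "f e = 0"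
          using sU[OF e'(1) zV[OF e'(1)]] openin_subset[OF U[OF e'(1)]] by auto
      qed simp
      also have "\<dots> = (\<Sum>e\<in>F. f (s e z))" using F(1) inj by (simp add: sum.reindex)
      finally show ?thesis .
    qed
    have "continuous_map (subtopology Y N) euclidean (\<lambda>z. \<Sum>e\<in>F. f (s e z))"
    proof (rule continuous_map_sum[OF F(1)])
      fix e assume e: "e \<in> F"
      have "continuous_map (subtopology Y N) X (s e)"
        by (rule continuous_map_from_subtopology_mono[of Y "V e"])
          (use UVs(1)[OF e] e in \<open>auto simp: local_inverse_def N_def\<close>)
      from continuous_map_compose[OF this ccont_cont[OF f]]
      show "continuous_map (subtopology Y N) euclidean (\<lambda>z. f (s e z))" by (simp add: o_def)
    qed
    then have "continuous_map (subtopology Y N) euclidean (fibre_sum X p f)"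
      by (rule continuous_map_eq) (use eq in auto)
    then show ?thesis using N yN by blast
  qed
  then have "continuous_map Y euclidean (fibre_sum X p f)" by (rule continuous_map_locally)
  moreover have "compactin Y (p ` K)" by (rule image_compactin[OF K(1) cp])
  moreover have "fibre_sum X p f y = 0" if "y \<notin> p ` K" for y
    unfolding fibre_sum_def using K(2) that by (intro infsum_0) blast
  ultimately show ?thesis by (intro ccontI)
qed

end

section \<open>Integrals depending on a parameter\<close>

lemma ccont_slice:
  assumes h: "ccont (prod_topology X Y) h" and v: "v \<in> topspace X"
  shows "ccont Y (\<lambda>w. h (v, w))"
proof -
  obtain K where K: "compactin (prod_topology X Y) K" "\<And>z. z \<in> topspace (prod_topology X Y) \<Longrightarrow> z \<notin> K \<Longrightarrow> h z = 0"
    using h by (rule ccontE) blast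
  show ?thesis
  proof (rule ccontI)
    have "continuous_map Y (prod_topology X Y) (\<lambda>w. (v, w))"
      using v by (intro continuous_map_pairedI) auto
    from continuous_map_compose[OF this ccont_cont[OF h]]
    show "continuous_map Y euclidean (\<lambda>w. h (v, w))" by (simp add: o_def)
    show "compactin Y (snd ` K)" by (rule image_compactin[OF K(1) continuous_map_snd])
    show "h (v, w) = 0" if "w \<in> topspace Y" "w \<notin> snd ` K" for w
      using that K(2)[of "(v, w)"] v by force
  qed
qed

text \<open>All slices of \<open>h\<close> vanish off the projection \<open>L\<close> of a compact
  carrier, and \<open>L\<close> has finite measure. The tube lemma along \<open>L\<close> makes the
  slices at \<open>v\<close> near \<open>v0\<close> uniformly close to the slice at
  \<open>v0\<close>, so the integrals are close.\<close>

lemma ccont_parameter_integral: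
  fixes h :: "'a \<times> 'b \<Rightarrow> 'c :: {banach, second_countable_topology}"
  assumes h: "ccont (prod_topology X Y) h"
    and M: "radon_measure Y M" and HY: "Hausdorff_space Y"
  shows "ccont X (\<lambda>v. LINT w|M. h (v, w))"
proof -
  obtain K where K: "compactin (prod_topology X Y) K"
      "\<And>z. z \<in> topspace (prod_topology X Y) \<Longrightarrow> z \<notin> K \<Longrightarrow> h z = 0"
    using h by (rule ccontE) blast
  define L where "L = snd ` K"
  have L: "compactin Y L" unfolding L_def by (rule image_compactin[OF K(1) continuous_map_snd])
  have h0: "h (v, w) = 0" if "v \<in> topspace X" "w \<in> topspace Y" "w \<notin> L" for v w
    using K(2)[of "(v, w)"] that by (force simp: L_def)
  note Lm = radon_compact_sets[OF M HY L] and Lf = radon_compact_finite[OF M L]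
  have "\<exists>U. openin X U \<and> v0 \<in> U \<and>
      (\<forall>v\<in>U. (LINT w|M. h (v, w)) \<in> Met_TC.mball (LINT w|M. h (v0, w)) \<epsilon>)"
    if v0: "v0 \<in> topspace X" and \<epsilon>: "\<epsilon> > 0" for v0 \<epsilon>
  proof -
    \<comment> \<open>The \<open>+ 1\<close> guards against \<open>L\<close> being a null set and
      makes the final estimate strict.\<close>
    define \<delta> where "\<delta> = \<epsilon> / (measure M L + 1)"
    have \<delta>: "\<delta> > 0" using \<epsilon> by (simp add: \<delta>_def add_nonneg_pos)
    let ?d = "\<lambda>z. norm (h z - h (v0, snd z))"
    let ?W = "{z \<in> topspace (prod_topology X Y). ?d z \<in> {..<\<delta>}}"
    have "continuous_map (prod_topology X Y) Y snd" by (rule continuous_map_snd)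
    from continuous_map_compose[OF this ccont_cont[OF ccont_slice[OF h v0]]]
    have "continuous_map (prod_topology X Y) euclideanreal ?d"
      using ccont_cont[OF h] by (intro continuous_map_norm continuous_map_diff) (auto simp: o_def)
    then have W: "openin (prod_topology X Y) ?W"
      by (rule openin_continuous_map_preimage) auto
    have "{v0} \<times> L \<subseteq> ?W" using v0 \<delta> compactin_subset_topspace[OF L] by auto
    from tube_lemma_right[OF W L v0 this]
    obtain U V where UV: "openin X U" "openin Y V" "v0 \<in> U" "L \<subseteq> V" "U \<times> V \<subseteq> ?W" by blast
    have "norm ((LINT w|M. h (v, w)) - (LINT w|M. h (v0, w))) < \<epsilon>" if v: "v \<in> U" for v
    proof -
      have vX: "v \<in> topspace X" using v UV(1) openin_subset by blast
      note i = radon_integrable[OF M HY ccont_slice[OF h vX]] radon_integrable[OF M HY ccont_slice[OF h v0]]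
      have "norm ((LINT w|M. h (v, w)) - (LINT w|M. h (v0, w))) = norm (LINT w|M. h (v, w) - h (v0, w))"
        using i by simp
      also have "\<dots> \<le> (LINT w|M. norm (h (v, w) - h (v0, w)))" by (rule integral_norm_bound)
      also have "\<dots> \<le> (LINT w|M. \<delta> * indicator L w)"
      proof (rule integral_mono)
        show "integrable M (\<lambda>w. norm (h (v, w) - h (v0, w)))" using i by simp
        show "integrable M (\<lambda>w. \<delta> * indicator L w)"
          using Lm Lf by (simp add: integrable_indicator_iff)
        fix w assume "w \<in> space M"
        then have w: "w \<in> topspace Y" using radon_space[OF M] by simp
        show "norm (h (v, w) - h (v0, w)) \<le> \<delta> * indicator L w"
        proof (cases "w \<in> L")
          case True
          then have "(v, w) \<in> ?W" using v UV by blast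
          then show ?thesis using True by simp
        qed (simp add: h0 w vX v0)
      qed
      also have "\<dots> = \<delta> * measure M L" using Lm by simp
      also have "\<dots> < \<epsilon>"
        using \<epsilon> measure_nonneg[of M L] by (simp add: \<delta>_def pos_divide_less_eq add_nonneg_pos)
      finally show ?thesis .
    qed
    then show ?thesis using UV(1,3) by (auto simp: dist_norm norm_minus_commute)
  qed
  then have "continuous_map X Met_TC.mtopology (\<lambda>v. LINT w|M. h (v, w))"
    unfolding Met_TC.continuous_map_to_metric by blast
  then have cont: "continuous_map X euclidean (\<lambda>v. LINT w|M. h (v, w))" by simp
  show ?thesis
  proof (rule ccontI[OF cont])
    show "compactin X (fst ` K)" by (rule image_compactin[OF K(1) continuous_map_fst])
    fix v assume v: "v \<in> topspace X" "v \<notin> fst ` K"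
    have "h (v, w) = 0" if "w \<in> space M" for w
      using that v K(2)[of "(v, w)"] radon_space[OF M] by force
    then have "(LINT w|M. h (v, w)) = (LINT w|M. 0)" by (intro Bochner_Integration.integral_cong) auto
    then show "(LINT w|M. h (v, w)) = 0" by simp
  qed
qed

section \<open>Locally trivial groupoids\<close>

context groupoid
begin

lemma mult_arrow:
  assumes "a \<in> arrows G" "b \<in> arrows G" "src G a = rng G b"
  shows "a \<cdot> b \<in> arrows G" "rng G (a \<cdot> b) = rng G a" "src G (a \<cdot> b) = src G b"
  using assms mult_closed[of a b] rng_mult[of a b] src_mult[of a b] by (auto simp: composable_def)

lemma inv_mult_cancel:
  assumes "a \<in> arrows G" "b \<in> arrows G" "src G a = rng G b"
  shows "ginv G a \<cdot> (a \<cdot> b) = b"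
proof -
  have "ginv G a \<cdot> (a \<cdot> b) = (ginv G a \<cdot> a) \<cdot> b"
    using assms inv_closed src_inv by (intro mult_assoc[symmetric]) (auto simp: composable_def)
  then show ?thesis using assms mult_left_inv mult_left_unit by simp
qed

lemma mult_inv_cancel:
  assumes "a \<in> arrows G" "b \<in> arrows G" "rng G a = rng G b"
  shows "a \<cdot> (ginv G a \<cdot> b) = b"
proof -
  have "a \<cdot> (ginv G a \<cdot> b) = (a \<cdot> ginv G a) \<cdot> b"
    using assms inv_closed src_inv rng_inv by (intro mult_assoc[symmetric]) (auto simp: composable_def)
  then show ?thesis using assms mult_right_inv mult_left_unit by simp
qed

lemma mult_inv_mult_cancel:
  assumes "a \<in> arrows G" "b \<in> arrows G" "src G a = src G b"
  shows "(a \<cdot> ginv G b) \<cdot> b = a"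
proof -
  have "(a \<cdot> ginv G b) \<cdot> b = a \<cdot> (ginv G b \<cdot> b)"
    using assms inv_closed src_inv rng_inv by (intro mult_assoc) (auto simp: composable_def)
  then show ?thesis using assms mult_left_inv mult_right_unit by metis
qed

lemma hom_fibre_iff: "\<gamma> \<in> hom_fibre G u w \<longleftrightarrow> \<gamma> \<in> arrows G \<and> rng G \<gamma> = u \<and> src G \<gamma> = w"
  by (auto simp: hom_fibre_def range_fibre_def source_fibre_def)

lemma range_fibre_iff: "\<gamma> \<in> range_fibre G u \<longleftrightarrow> \<gamma> \<in> arrows G \<and> rng G \<gamma> = u"
  by (auto simp: range_fibre_def)

lemma unit_in_range_fibre: "u \<in> units G \<Longrightarrow> u \<in> range_fibre G u"
  using units_subset rng_unit by (auto simp: range_fibre_iff)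

lemma bij_betw_left_translation:
  assumes "\<gamma> \<in> arrows G"
  shows "bij_betw (\<lambda>\<eta>. \<gamma> \<cdot> \<eta>) (hom_fibre G (src G \<gamma>) w) (hom_fibre G (rng G \<gamma>) w)"
proof (rule bij_betw_byWitness[where f' = "\<lambda>\<eta>. ginv G \<gamma> \<cdot> \<eta>"])
  show "\<forall>a\<in>hom_fibre G (src G \<gamma>) w. ginv G \<gamma> \<cdot> (\<gamma> \<cdot> a) = a"
    using assms inv_mult_cancel by (auto simp: hom_fibre_iff)
  show "\<forall>a\<in>hom_fibre G (rng G \<gamma>) w. \<gamma> \<cdot> (ginv G \<gamma> \<cdot> a) = a"
    using assms mult_inv_cancel by (auto simp: hom_fibre_iff)
  show "(\<lambda>\<eta>. \<gamma> \<cdot> \<eta>) ` hom_fibre G (src G \<gamma>) w \<subseteq> hom_fibre G (rng G \<gamma>) w"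
    using assms mult_arrow by (auto simp: hom_fibre_iff)
  show "(\<lambda>\<eta>. ginv G \<gamma> \<cdot> \<eta>) ` hom_fibre G (rng G \<gamma>) w \<subseteq> hom_fibre G (src G \<gamma>) w"
    using assms mult_arrow inv_closed rng_inv src_inv by (auto simp: hom_fibre_iff)
qed

lemma bij_betw_inv_translation:
  assumes "\<eta> \<in> hom_fibre G x v"
  shows "bij_betw (\<lambda>\<gamma>. ginv G \<eta> \<cdot> \<gamma>) (hom_fibre G x w) (hom_fibre G v w)"
  using bij_betw_left_translation[of "ginv G \<eta>" w] assms inv_closed rng_inv src_inv
  by (simp add: hom_fibre_iff)

lemma topspace_unit_space: "topspace (unit_space G) = units G"
  using units_subset by (auto simp: unit_space_def)

end

section \<open>Continuity of composites and inverses\<close>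

context topological_groupoid
begin

abbreviation fibre_top :: "'a \<Rightarrow> 'a topology"
  where "fibre_top u \<equiv> subtopology (gtop G) (range_fibre G u)"

lemma topspace_fibre_top: "topspace (fibre_top u) = range_fibre G u"
  by (auto simp: range_fibre_def)

lemma continuous_map_unit_space_imp: "continuous_map T (unit_space G) f \<Longrightarrow> continuous_map T (gtop G) f"
  by (simp add: unit_space_def continuous_map_in_subtopology)

lemma continuous_map_groupoid_mult:
  assumes a: "continuous_map T (gtop G) a" and b: "continuous_map T (gtop G) b"
    and comp: "\<And>t. t \<in> topspace T \<Longrightarrow> src G (a t) = rng G (b t)"
  shows "continuous_map T (gtop G) (\<lambda>t. a t \<cdot> b t)"
proof -
  have "a t \<in> arrows G" "b t \<in> arrows G" if "t \<in> topspace T" for t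
    using continuous_map_funspace[OF a] continuous_map_funspace[OF b] that by auto
  then have "continuous_map T (subtopology (prod_topology (gtop G) (gtop G)) (composable G)) (\<lambda>t. (a t, b t))"
    using a b comp by (auto simp: continuous_map_in_subtopology composable_def intro!: continuous_map_pairedI)
  from continuous_map_compose[OF this continuous_mult] show ?thesis by (simp add: o_def)
qed

lemma continuous_map_groupoid_inv:
  "continuous_map T (gtop G) a \<Longrightarrow> continuous_map T (gtop G) (\<lambda>t. ginv G (a t))"
  using continuous_map_compose[OF _ continuous_inv] by (auto simp: o_def)

end

text \<open>Preimages of separating sets are open in \<open>S\<close>, hence in \<open>X\<close>.
  Allowing \<open>f\<close> to be continuous on \<open>S\<close> only matters for translations by
  local sections, which exist only near a given unit.\<close>

lemma Hausdorff_separation_by_map: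
  assumes O: "openin X S" and f: "continuous_map (subtopology X S) Y f" and Y: "Hausdorff_space Y"
    and p: "p \<in> S" "q \<in> S" "f p \<noteq> f q"
  shows "\<exists>U V. openin X U \<and> openin X V \<and> p \<in> U \<and> q \<in> V \<and> disjnt U V"
proof -
  have t: "topspace (subtopology X S) = S" using openin_subset[OF O] by auto
  have "f p \<in> topspace Y" "f q \<in> topspace Y"
    using continuous_map_funspace[OF f] p t by auto
  then obtain U V where UV: "openin Y U" "openin Y V" "f p \<in> U" "f q \<in> V" "disjnt U V"
    using Y p(3) unfolding Hausdorff_space_def by metis
  have "openin X {z \<in> S. f z \<in> U}" "openin X {z \<in> S. f z \<in> V}"
    using openin_continuous_map_preimage[OF f UV(1), unfolded t]
      openin_continuous_map_preimage[OF f UV(2), unfolded t] openin_open_subtopology[OF O]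
    by blast+
  then show ?thesis
    using UV p by (intro exI[of _ "{z \<in> S. f z \<in> U}"] exI[of _ "{z \<in> S. f z \<in> V}"]) (auto simp: disjnt_def)
qed

section \<open>Separation of arrows from local triviality\<close>

locale locally_trivial_groupoid = locally_compact_groupoid +
  assumes locally_trivial: "locally_trivial G"
begin

text \<open>This is the form in which local triviality is used: a continuous section of the source
  map through a given arrow, with all its values in the same range fibre.\<close>

lemma fibre_section:
  assumes "b \<in> range_fibre G u"
  obtains U V s where "local_inverse (fibre_top u) (unit_space G) (src G) U V s" "b \<in> U"
    "s (src G b) = b" "src G b \<in> V" "V \<subseteq> units G"
    "\<And>y. y \<in> V \<Longrightarrow> s y \<in> arrows G \<and> rng G (s y) = u \<and> src G (s y) = y"
    "continuous_map (subtopology (unit_space G) V) (gtop G) s"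
proof -
  have "u \<in> units G" using assms rng_closed by (auto simp: range_fibre_iff)
  then have "local_homeomorphism (fibre_top u) (unit_space G) (src G)"
    using locally_trivial by (simp add: locally_trivial_def)
  moreover have "b \<in> topspace (fibre_top u)" using assms topspace_fibre_top by simp
  ultimately obtain U V s where L: "local_inverse (fibre_top u) (unit_space G) (src G) U V s" "b \<in> U"
    by (rule local_homeomorphism_imp_local_inverse)
  have "U \<subseteq> range_fibre G u" "V \<subseteq> units G"
    using L openin_subset[of "fibre_top u" U] openin_subset[of "unit_space G" V]
    by (auto simp: local_inverse_def topspace_fibre_top topspace_unit_space)
  then show thesis
    using L by (intro that[of U V s]) (auto simp: local_inverse_def range_fibre_iff continuous_map_in_subtopology)
qed

text \<open>The isotropy groups are discrete.\<close>

lemma openin_isotropy_level: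
  assumes \<psi>: "continuous_map T (gtop G) \<psi>"
    and iso: "\<And>t. t \<in> topspace T \<Longrightarrow> \<psi> t \<in> hom_fibre G u w"
  shows "openin T {t \<in> topspace T. \<psi> t = h}"
proof (cases "h \<in> hom_fibre G u w")
  case True
  then have h: "h \<in> range_fibre G u" "src G h = w" by (auto simp: hom_fibre_iff range_fibre_iff)
  obtain U V s where L: "local_inverse (fibre_top u) (unit_space G) (src G) U V s" "h \<in> U"
    using fibre_section[OF h(1)] by metis
  have "continuous_map T (fibre_top u) \<psi>"
    using \<psi> iso by (auto simp: continuous_map_in_subtopology range_fibre_iff hom_fibre_iff)
  moreover have "openin (fibre_top u) U" using L by (simp add: local_inverse_def)
  ultimately have "openin T {t \<in> topspace T. \<psi> t \<in> U}"
    by (rule openin_continuous_map_preimage)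
  moreover
  \<comment> \<open>The source map is injective on the sheet \<open>U\<close>, and all values of
    \<open>\<psi>\<close> have the source \<open>w\<close> of \<open>h\<close>.\<close>
  have "\<psi> t = h" if "t \<in> topspace T" "\<psi> t \<in> U" for t
  proof -
    have "src G (\<psi> t) = src G h" using iso[OF that(1)] h(2) by (simp add: hom_fibre_iff)
    then show ?thesis using L that(2) unfolding local_inverse_def by metis
  qed
  then have "{t \<in> topspace T. \<psi> t \<in> U} = {t \<in> topspace T. \<psi> t = h}" using L(2) by blast
  ultimately show ?thesis by simp
next
  case False
  then have "{t \<in> topspace T. \<psi> t = h} = {}" using iso by blast
  then show ?thesis by (simp only: openin_empty)
qed

text \<open>Arrows with different sources are separated by the source map. If \<open>b\<close> and
  \<open>b'\<close> have the same source, a local section \<open>s\<close> through \<open>b\<close>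
  gives the right translation \<open>\<psi>\<close>, which sends nearby arrows of the fibre into the
  isotropy group at \<open>u\<close>. Right multiplication by \<open>b\<close> recovers
  \<open>b\<close> and \<open>b'\<close>, so \<open>\<psi>\<close> tells them apart, and its level
  sets are open because that group is discrete.\<close>

lemma Hausdorff_fibre_top: "Hausdorff_space (fibre_top u)"
  unfolding Hausdorff_space_def topspace_fibre_top
proof (intro allI impI, elim conjE)
  fix b b' assume b: "b \<in> range_fibre G u" "b' \<in> range_fibre G u" "b \<noteq> b'"
  have src: "continuous_map (fibre_top u) (unit_space G) (src G)"
    by (intro continuous_map_from_subtopology continuous_src)
  show "\<exists>U V. openin (fibre_top u) U \<and> openin (fibre_top u) V \<and> b \<in> U \<and> b' \<in> V \<and> disjnt U V"
  proof (cases "src G b = src G b'")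
    case False
    show ?thesis
    proof (rule Hausdorff_separation_by_map[of _ "topspace (fibre_top u)" "unit_space G" "src G"])
      show "openin (fibre_top u) (topspace (fibre_top u))" by (rule openin_topspace)
      show "continuous_map (subtopology (fibre_top u) (topspace (fibre_top u))) (unit_space G) (src G)"
        using src by (simp only: subtopology_topspace)
    qed (use b Hausdorff_unit_space False in \<open>simp_all only: topspace_fibre_top not_False_eq_True\<close>)
  next
    case True
    obtain U V s where s: "local_inverse (fibre_top u) (unit_space G) (src G) U V s"
        "s (src G b) = b" "src G b \<in> V" "V \<subseteq> units G"
        "\<And>y. y \<in> V \<Longrightarrow> s y \<in> arrows G \<and> rng G (s y) = u \<and> src G (s y) = y"
        "continuous_map (subtopology (unit_space G) V) (gtop G) s"
      using fibre_section[OF b(1)] by metis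
    have V: "openin (unit_space G) V" using s(1) by (simp add: local_inverse_def)
    define S where "S = {c \<in> range_fibre G u. src G c \<in> V}"
    have S: "openin (fibre_top u) S"
      using openin_continuous_map_preimage[OF src V] unfolding S_def topspace_fibre_top by simp
    let ?T = "subtopology (fibre_top u) S"
    have T: "topspace ?T = S" by (auto simp: S_def range_fibre_iff)
    define \<psi> where "\<psi> c = c \<cdot> ginv G (s (src G c))" for c
    have "continuous_map ?T (subtopology (unit_space G) V) (src G)"
      using src by (auto simp: continuous_map_in_subtopology S_def intro: continuous_map_from_subtopology)
    from continuous_map_compose[OF this s(6)]
    have "continuous_map ?T (gtop G) (\<lambda>c. s (src G c))" by (simp add: o_def)
    moreover have "continuous_map ?T (gtop G) (\<lambda>c. c)"
      by (simp add: continuous_map_from_subtopology)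
    ultimately have cont: "continuous_map ?T (gtop G) \<psi>"
      unfolding \<psi>_def using s(5) rng_inv
      by (intro continuous_map_groupoid_mult continuous_map_groupoid_inv) (auto simp: S_def)
    have hom: "\<psi> c \<in> hom_fibre G u u" if "c \<in> S" for c
      using that s(5) inv_closed rng_inv src_inv mult_arrow
      by (auto simp: S_def \<psi>_def hom_fibre_iff range_fibre_iff)
    have level: "openin (fibre_top u) {c \<in> S. \<psi> c = h}" for h
      using openin_isotropy_level[OF cont, unfolded T, of u u h] hom openin_open_subtopology[OF S] by blast
    have "\<psi> b \<noteq> \<psi> b'"
      using mult_inv_mult_cancel[of b b] mult_inv_mult_cancel[of b' b] b True s(2)
      by (auto simp: \<psi>_def range_fibre_iff)
    then show ?thesis
      using level[of "\<psi> b"] level[of "\<psi> b'"] b True s(3)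
      by (intro exI[of _ "{c \<in> S. \<psi> c = \<psi> b}"] exI[of _ "{c \<in> S. \<psi> c = \<psi> b'}"])
        (auto simp: S_def disjnt_def)
  qed
qed

text \<open>Near the unit \<open>u\<close> a section of the source map moves arrows continuously into the fibre over \<open>u\<close>.\<close>

lemma move_range:
  assumes "u \<in> units G"
  obtains V \<tau> where "openin (unit_space G) V" "u \<in> V" "V \<subseteq> units G" "\<tau> u = u"
    "\<And>y. y \<in> V \<Longrightarrow> \<tau> y \<in> arrows G \<and> rng G (\<tau> y) = u \<and> src G (\<tau> y) = y"
    "continuous_map (subtopology (unit_space G) V) (gtop G) \<tau>"
    "openin (gtop G) {c \<in> arrows G. rng G c \<in> V}"
    "continuous_map (subtopology (gtop G) {c \<in> arrows G. rng G c \<in> V}) (fibre_top u) (\<lambda>c. \<tau> (rng G c) \<cdot> c)"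
proof -
  \<comment> \<open>The section passes through the unit \<open>u\<close> itself, so
    \<open>\<tau> u = u\<close> and the translation fixes every arrow with range
    \<open>u\<close>.\<close>
  obtain U V \<tau> where s: "local_inverse (fibre_top u) (unit_space G) (src G) U V \<tau>"
      "\<tau> (src G u) = u" "src G u \<in> V" "V \<subseteq> units G"
      "\<And>y. y \<in> V \<Longrightarrow> \<tau> y \<in> arrows G \<and> rng G (\<tau> y) = u \<and> src G (\<tau> y) = y"
      "continuous_map (subtopology (unit_space G) V) (gtop G) \<tau>"
    using fibre_section[OF unit_in_range_fibre[OF assms]] by metis
  have V: "openin (unit_space G) V" using s(1) by (simp add: local_inverse_def)
  let ?S = "{c \<in> arrows G. rng G c \<in> V}"
  have S: "openin (gtop G) ?S"
    by (rule openin_continuous_map_preimage[OF continuous_rng V])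
  have "continuous_map (subtopology (gtop G) ?S) (subtopology (unit_space G) V) (rng G)"
    using continuous_rng by (auto simp: continuous_map_in_subtopology intro: continuous_map_from_subtopology)
  from continuous_map_compose[OF this s(6)]
  have "continuous_map (subtopology (gtop G) ?S) (gtop G) (\<lambda>c. \<tau> (rng G c))" by (simp add: o_def)
  then have "continuous_map (subtopology (gtop G) ?S) (gtop G) (\<lambda>c. \<tau> (rng G c) \<cdot> c)"
    using s(5) by (intro continuous_map_groupoid_mult) (auto simp: continuous_map_from_subtopology)
  then have "continuous_map (subtopology (gtop G) ?S) (fibre_top u) (\<lambda>c. \<tau> (rng G c) \<cdot> c)"
    using s(5) mult_arrow by (auto simp: continuous_map_in_subtopology range_fibre_iff)
  then show thesis using that[OF V _ s(4) _ s(5,6) S] s(2,3) src_unit[OF assms] by simp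
qed

text \<open>Arrows with different ranges are separated by the range map. Two arrows with the same
  range are fixed by the translation of \<open>move_range\<close>, which is continuous on an open
  set containing both and takes values in a single range fibre, already known to be
  Hausdorff.\<close>

theorem Hausdorff_gtop: "Hausdorff_space (gtop G)"
  unfolding Hausdorff_space_def
proof (intro allI impI, elim conjE)
  fix b b' assume b: "b \<in> arrows G" "b' \<in> arrows G" "b \<noteq> b'"
  show "\<exists>U V. openin (gtop G) U \<and> openin (gtop G) V \<and> b \<in> U \<and> b' \<in> V \<and> disjnt U V"
  proof (cases "rng G b = rng G b'")
    case False
    show ?thesis
      by (rule Hausdorff_separation_by_map[of _ "arrows G" "unit_space G" "rng G"])
        (use b continuous_rng Hausdorff_unit_space False in auto)
  next
    case True
    obtain V \<tau> where V: "openin (unit_space G) V" "(rng G b) \<in> V" "V \<subseteq> units G" "\<tau> (rng G b) = (rng G b)"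
      "\<And>y. y \<in> V \<Longrightarrow> \<tau> y \<in> arrows G \<and> rng G (\<tau> y) = (rng G b) \<and> src G (\<tau> y) = y"
      "continuous_map (subtopology (unit_space G) V) (gtop G) \<tau>"
      "openin (gtop G) {c \<in> arrows G. rng G c \<in> V}"
      "continuous_map (subtopology (gtop G) {c \<in> arrows G. rng G c \<in> V}) (fibre_top (rng G b)) (\<lambda>c. \<tau> (rng G c) \<cdot> c)"
      by (rule move_range[OF rng_closed[OF b(1)]]) blast
    have "\<tau> (rng G b) \<cdot> b = b" "\<tau> (rng G b') \<cdot> b' = b'"
      using V(4) True b mult_left_unit by metis+
    then show ?thesis
      by (intro Hausdorff_separation_by_map[OF V(7,8) Hausdorff_fibre_top]) (use b True V(2) in auto)
  qed
qed

lemma locally_compact_gtop: "locally_compact_space (gtop G)"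
  unfolding locally_compact_space_def using compact_Hausdorff_nbhd by blast

text \<open>The units are the fixed points of the range map, a closed condition once
  \<open>G\<close> is Hausdorff. Closedness passes local compactness to the unit space, where a
  cutoff function will be needed.\<close>

lemma closedin_units: "closedin (gtop G) (units G)"
proof -
  have "closedin (gtop G) {c \<in> arrows G. rng G c = c}"
    by (intro closedin_continuous_maps_eq[OF Hausdorff_gtop] continuous_map_unit_space_imp[OF continuous_rng]) simp
  moreover have "{c \<in> arrows G. rng G c = c} = units G"
    using rng_unit rng_closed units_subset by force
  ultimately show ?thesis by simp
qed

lemma locally_compact_unit_space: "locally_compact_space (unit_space G)"
  unfolding unit_space_def
  by (rule locally_compact_space_closed_subset[OF locally_compact_gtop closedin_units])

lemma closedin_range_fibre: "closedin (gtop G) (range_fibre G u)"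
proof (cases "u \<in> units G")
  case True
  have "closedin (gtop G) {c \<in> arrows G. rng G c \<in> {u}}"
    using True Hausdorff_unit_space
    by (intro closedin_continuous_map_preimage[OF continuous_rng])
      (simp add: closedin_Hausdorff_singleton topspace_unit_space)
  then show ?thesis by (simp add: range_fibre_def)
next
  case False
  then have "range_fibre G u = {}" using rng_closed by (auto simp: range_fibre_iff)
  then show ?thesis by simp
qed

section \<open>The local homeomorphism from arrows to pairs of units\<close>

abbreviation rs :: "'a \<Rightarrow> 'a \<times> 'a"
  where "rs \<gamma> \<equiv> (rng G \<gamma>, src G \<gamma>)"

abbreviation pairs :: "('a \<times> 'a) topology"
  where "pairs \<equiv> prod_topology (unit_space G) (unit_space G)"

lemma continuous_map_rs: "continuous_map (gtop G) pairs rs"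
  by (intro continuous_map_pairedI continuous_rng continuous_src)

lemma Hausdorff_pairs: "Hausdorff_space pairs"
  by (simp add: Hausdorff_space_prod_topology Hausdorff_unit_space)

lemma rs_local_inverse:
  assumes \<gamma>: "\<gamma> \<in> arrows G"
  shows "\<exists>U V s. local_inverse (gtop G) pairs rs U V s \<and> \<gamma> \<in> U"
proof -
  define u where "u = rng G \<gamma>"
  have u: "u \<in> units G" using \<gamma> rng_closed by (simp add: u_def)
  obtain V \<tau> where V: "openin (unit_space G) V" "u \<in> V" "V \<subseteq> units G" "\<tau> u = u"
      "\<And>y. y \<in> V \<Longrightarrow> \<tau> y \<in> arrows G \<and> rng G (\<tau> y) = u \<and> src G (\<tau> y) = y"
      "continuous_map (subtopology (unit_space G) V) (gtop G) \<tau>"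
      "openin (gtop G) {c \<in> arrows G. rng G c \<in> V}"
      "continuous_map (subtopology (gtop G) {c \<in> arrows G. rng G c \<in> V}) (fibre_top u) (\<lambda>c. \<tau> (rng G c) \<cdot> c)"
    by (rule move_range[OF u]) blast
  have "\<gamma> \<in> range_fibre G u" using \<gamma> by (simp add: range_fibre_iff u_def)
  then obtain W Q \<sigma> where W: "local_inverse (fibre_top u) (unit_space G) (src G) W Q \<sigma>" "\<gamma> \<in> W"
      "\<sigma> (src G \<gamma>) = \<gamma>" "src G \<gamma> \<in> Q" "Q \<subseteq> units G"
      "\<And>y. y \<in> Q \<Longrightarrow> \<sigma> y \<in> arrows G \<and> rng G (\<sigma> y) = u \<and> src G (\<sigma> y) = y"
      "continuous_map (subtopology (unit_space G) Q) (gtop G) \<sigma>"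
    by (rule fibre_section) blast
  have WQ: "openin (fibre_top u) W" "openin (unit_space G) Q" "\<And>q. q \<in> W \<Longrightarrow> src G q \<in> Q \<and> \<sigma> (src G q) = q"
      "\<And>y. y \<in> Q \<Longrightarrow> \<sigma> y \<in> W"
    using W(1) by (auto simp: local_inverse_def)
  let ?S = "{c \<in> arrows G. rng G c \<in> V}"
  \<comment> \<open>Translation by \<open>\<tau>\<close> keeps the source and moves the range to
    \<open>u\<close>; once the moved arrow lies in the sheet \<open>W\<close>, its source alone
    determines it through \<open>\<sigma>\<close>, and undoing the translation recovers
    \<open>c\<close>.\<close>
  let ?U = "{c \<in> ?S. \<tau> (rng G c) \<cdot> c \<in> W}"
  let ?s = "\<lambda>(v, w). ginv G (\<tau> v) \<cdot> \<sigma> w"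
  have "openin (subtopology (gtop G) ?S) ?U"
    using openin_continuous_map_preimage[OF V(8) WQ(1)] by (simp add: Int_absorb1)
  then have U: "openin (gtop G) ?U" using V(7) openin_open_subtopology by blast
  let ?Z = "subtopology pairs (V \<times> Q)"
  have "continuous_map ?Z (subtopology (unit_space G) V) fst"
    "continuous_map ?Z (subtopology (unit_space G) Q) snd"
    by (auto simp: continuous_map_in_subtopology continuous_map_from_subtopology continuous_map_fst continuous_map_snd)
  from continuous_map_compose[OF this(1) V(6)] continuous_map_compose[OF this(2) W(7)]
  have c: "continuous_map ?Z (gtop G) (\<lambda>z. \<tau> (fst z))" "continuous_map ?Z (gtop G) (\<lambda>z. \<sigma> (snd z))"
    by (simp_all add: o_def)
  have "continuous_map ?Z (gtop G) (\<lambda>z. ginv G (\<tau> (fst z)) \<cdot> \<sigma> (snd z))"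
    using V(5) W(6) src_inv
    by (intro continuous_map_groupoid_mult continuous_map_groupoid_inv c) auto
  then have cs: "continuous_map ?Z (gtop G) ?s" by (simp add: case_prod_beta')
  have "local_inverse (gtop G) pairs rs ?U (V \<times> Q) ?s"
    unfolding local_inverse_def
  proof (intro conjI ballI U cs)
    show "openin pairs (V \<times> Q)" using V(1) WQ(2) by (simp add: openin_prod_Times_iff)
    fix c assume c: "c \<in> ?U"
    then have ca: "c \<in> arrows G" and cV: "rng G c \<in> V" and cW: "\<tau> (rng G c) \<cdot> c \<in> W" by auto
    have sc: "src G (\<tau> (rng G c) \<cdot> c) = src G c" using V(5)[OF cV] ca mult_arrow(3) by simp
    show "rs c \<in> V \<times> Q" using cV WQ(3)[OF cW] sc by simp
    have "\<sigma> (src G c) = \<tau> (rng G c) \<cdot> c" using WQ(3)[OF cW] sc by simp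
    then show "?s (rs c) = c" using inv_mult_cancel V(5)[OF cV] ca by simp
  next
    fix y assume "y \<in> V \<times> Q"
    then obtain v w where y: "y = (v, w)" "v \<in> V" "w \<in> Q" by auto
    note \<tau> = V(5)[OF y(2)] and \<sigma> = W(6)[OF y(3)]
    have m: "ginv G (\<tau> v) \<cdot> \<sigma> w \<in> arrows G" "rng G (ginv G (\<tau> v) \<cdot> \<sigma> w) = v" "src G (ginv G (\<tau> v) \<cdot> \<sigma> w) = w"
      using \<tau> \<sigma> inv_closed rng_inv src_inv mult_arrow[of "ginv G (\<tau> v)" "\<sigma> w"] by auto
    have "\<tau> v \<cdot> (ginv G (\<tau> v) \<cdot> \<sigma> w) = \<sigma> w" using \<tau> \<sigma> by (intro mult_inv_cancel) auto
    then show "?s y \<in> ?U" using m y WQ(4)[OF y(3)] by simp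
    show "rs (?s y) = y" using m y by simp
  qed
  moreover have "\<gamma> \<in> ?U"
  proof -
    have "\<tau> (rng G \<gamma>) \<cdot> \<gamma> = \<gamma>" using V(4) \<gamma> mult_left_unit u_def by metis
    then show ?thesis using \<gamma> V(2) W(2) by (simp add: u_def)
  qed
  ultimately show ?thesis by blast
qed

end

section \<open>The Haar system\<close>

locale haar_data = locally_trivial_groupoid +
  fixes \<nu> :: "'a measure"
  assumes radon_\<nu>: "radon_measure (unit_space G) \<nu>"
    and full_\<nu>: "fully_supported (unit_space G) \<nu>"
begin

definition arrow_sum :: "('a \<Rightarrow> 'b::real_normed_vector) \<Rightarrow> 'a \<Rightarrow> 'a \<Rightarrow> 'b"
  where "arrow_sum f v w = (\<Sum>\<^sub>\<infinity>\<gamma> \<in> hom_fibre G v w. f \<gamma>)"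

lemma rs_fibre: "{e \<in> arrows G. rs e = (v, w)} = hom_fibre G v w"
  by (auto simp: hom_fibre_iff)

lemma fibre_sum_rs: "fibre_sum (gtop G) rs f (v, w) = arrow_sum f v w"
  unfolding fibre_sum_def arrow_sum_def rs_fibre ..

lemmas rs_facts = Hausdorff_gtop Hausdorff_pairs continuous_map_rs rs_local_inverse

lemma summable_on_hom_fibre:
  fixes f :: "'a \<Rightarrow> 'b::real_normed_vector"
  assumes "ccont (gtop G) f" "v \<in> units G" "w \<in> units G"
  shows "f summable_on hom_fibre G v w"
  using summable_on_fibre[OF rs_facts assms(1), of "(v, w)"] assms(2,3)
  unfolding rs_fibre by (simp add: topspace_unit_space)

lemma ccont_arrow_sum_pairs:
  fixes f :: "'a \<Rightarrow> 'b::real_normed_vector"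
  assumes "ccont (gtop G) f"
  shows "ccont pairs (\<lambda>z. arrow_sum f (fst z) (snd z))"
proof (rule ccont_cong[OF ccont_fibre_sum[OF rs_facts assms]])
  show "fibre_sum (gtop G) rs f p = arrow_sum f (fst p) (snd p)" for p
    using fibre_sum_rs[of f "fst p" "snd p"] by (simp only: prod.collapse)
qed

lemma ccont_arrow_sum:
  fixes f :: "'a \<Rightarrow> 'b::real_normed_vector"
  assumes "ccont (gtop G) f" "v \<in> units G"
  shows "ccont (unit_space G) (arrow_sum f v)"
  using ccont_slice[OF ccont_arrow_sum_pairs[OF assms(1)], of v] assms(2)
  by (simp add: topspace_unit_space)

lemma integrable_arrow_sum:
  fixes f :: "'a \<Rightarrow> 'b::{banach, second_countable_topology}"
  assumes "ccont (gtop G) f" "v \<in> units G"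
  shows "integrable \<nu> (arrow_sum f v)"
  by (rule radon_integrable[OF radon_\<nu> Hausdorff_unit_space ccont_arrow_sum[OF assms]])

lemma space_\<nu>: "space \<nu> = units G"
  using radon_space[OF radon_\<nu>] topspace_unit_space by simp

text \<open>Translation by the inverse of \<open>\<eta>\<close> is a bijection of the index sets. On
  the right neither \<open>x\<close> nor \<open>\<eta>\<close> is left, which is why the measure
  depends only on \<open>v\<close>.\<close>

lemma translate_arrow_sum:
  assumes "\<eta> \<in> hom_fibre G x v"
  shows "(\<Sum>\<^sub>\<infinity>\<gamma> \<in> hom_fibre G x w. f (ginv G \<eta> \<cdot> \<gamma>)) = arrow_sum f v w"
  unfolding arrow_sum_def by (rule infsum_reindex_bij_betw[OF bij_betw_inv_translation[OF assms]])

section \<open>The Radon measures and their characterisation\<close>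

definition arrow_functional :: "'a \<Rightarrow> ('a \<Rightarrow> real) \<Rightarrow> real"
  where "arrow_functional v f = (LINT w|\<nu>. arrow_sum f v w)"

lemma positive_functional_arrow:
  assumes v: "v \<in> units G"
  shows "positive_functional (gtop G) (arrow_functional v)"
proof
  show "locally_compact_space (gtop G)" "Hausdorff_space (gtop G)"
    by (rule locally_compact_gtop, rule Hausdorff_gtop)
next
  fix f g :: "'a \<Rightarrow> real" assume fg: "ccont (gtop G) f" "ccont (gtop G) g"
  have "(LINT w|\<nu>. arrow_sum (\<lambda>p. f p + g p) v w) = (LINT w|\<nu>. arrow_sum f v w + arrow_sum g v w)"
    unfolding arrow_sum_def using fg v space_\<nu>
    by (intro Bochner_Integration.integral_cong refl infsum_add summable_on_hom_fibre) auto
  then show "arrow_functional v (\<lambda>p. f p + g p) = arrow_functional v f + arrow_functional v g"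
    using fg v by (simp add: arrow_functional_def integrable_arrow_sum)
next
  fix f :: "'a \<Rightarrow> real" and c
  show "arrow_functional v (\<lambda>p. c * f p) = c * arrow_functional v f"
    by (simp add: arrow_functional_def arrow_sum_def infsum_cmult_right')
next
  fix f :: "'a \<Rightarrow> real" assume "\<And>p. p \<in> arrows G \<Longrightarrow> 0 \<le> f p"
  then show "0 \<le> arrow_functional v f"
    unfolding arrow_functional_def arrow_sum_def
    by (intro integral_nonneg_AE AE_I2 infsum_nonneg) (auto simp: hom_fibre_iff)
qed

definition haar :: "'a \<Rightarrow> 'a measure"
  where "haar v = positive_functional.riesz (gtop G) (arrow_functional v)"

lemma radon_haar: "v \<in> units G \<Longrightarrow> radon_measure (gtop G) (haar v)"
  unfolding haar_def by (rule positive_functional.radon_riesz[OF positive_functional_arrow])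

lemma integral_haar_real:
  fixes f :: "'a \<Rightarrow> real"
  shows "v \<in> units G \<Longrightarrow> ccont (gtop G) f \<Longrightarrow> (LINT \<gamma>|haar v. f \<gamma>) = (LINT w|\<nu>. arrow_sum f v w)"
  unfolding haar_def
  using positive_functional.integral_riesz[OF positive_functional_arrow] by (simp add: arrow_functional_def)

text \<open>The Riesz theorem covers real functions; real and imaginary parts give the complex case,
  since they commute with the sums and integrals, which converge.\<close>

lemma integral_haar:
  fixes f :: "'a \<Rightarrow> complex"
  assumes v: "v \<in> units G" and f: "ccont (gtop G) f"
  shows "(LINT \<gamma>|haar v. f \<gamma>) = (LINT w|\<nu>. arrow_sum f v w)"
proof (rule complex_eqI)
  have c: "ccont (gtop G) (\<lambda>\<gamma>. Re (f \<gamma>))" "ccont (gtop G) (\<lambda>\<gamma>. Im (f \<gamma>))"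
    by (rule ccont_compose[OF f]; auto intro!: continuous_intros)+
  note i = radon_integrable[OF radon_haar[OF v] Hausdorff_gtop f] integrable_arrow_sum[OF f v]
  have s: "f summable_on hom_fibre G v w" if "w \<in> space \<nu>" for w
    using summable_on_hom_fibre[OF f v] that space_\<nu> by simp
  have "Re (LINT \<gamma>|haar v. f \<gamma>) = (LINT w|\<nu>. arrow_sum (\<lambda>\<gamma>. Re (f \<gamma>)) v w)"
    using i(1) integral_haar_real[OF v c(1)] by simp
  also have "\<dots> = (LINT w|\<nu>. Re (arrow_sum f v w))"
    unfolding arrow_sum_def by (intro Bochner_Integration.integral_cong refl infsum_Re s)
  finally show "Re (LINT \<gamma>|haar v. f \<gamma>) = Re (LINT w|\<nu>. arrow_sum f v w)" using i(2) by simp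
  have "Im (LINT \<gamma>|haar v. f \<gamma>) = (LINT w|\<nu>. arrow_sum (\<lambda>\<gamma>. Im (f \<gamma>)) v w)"
    using i(1) integral_haar_real[OF v c(2)] by simp
  also have "\<dots> = (LINT w|\<nu>. Im (arrow_sum f v w))"
    unfolding arrow_sum_def by (intro Bochner_Integration.integral_cong refl infsum_Im s)
  finally show "Im (LINT \<gamma>|haar v. f \<gamma>) = Im (LINT w|\<nu>. arrow_sum f v w)" using i(2) by simp
qed

text \<open>Real test functions are complex ones, so the defining formula fixes all integrals of
  real \<open>ccont\<close> functions, and a Radon measure is determined by these. The right side
  does not mention \<open>\<eta>\<close>, so this also shows independence of the chosen
  arrow.\<close>

lemma is_lambda_iff:
  assumes \<eta>: "\<eta> \<in> hom_fibre G x v"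
  shows "is_lambda G \<nu> x \<eta> L \<longleftrightarrow> L = haar v"
proof -
  have v: "v \<in> units G" using \<eta> src_closed by (auto simp: hom_fibre_iff)
  have char: "is_lambda G \<nu> x \<eta> L \<longleftrightarrow> radon_measure (gtop G) L \<and>
      (\<forall>f :: 'a \<Rightarrow> complex. ccont (gtop G) f \<longrightarrow> (LINT \<gamma>|L. f \<gamma>) = (LINT w|\<nu>. arrow_sum f v w))" for L
    by (simp add: is_lambda_def translate_arrow_sum[OF \<eta>] Ball_def Cc_iff_ccont[OF Hausdorff_gtop])
  show ?thesis
  proof
    assume L: "is_lambda G \<nu> x \<eta> L"
    show "L = haar v"
    proof (rule radon_measure_eqI[OF _ radon_haar[OF v] Hausdorff_gtop locally_compact_gtop])
      show "radon_measure (gtop G) L" using L char by blast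
      fix f :: "'a \<Rightarrow> real" assume "ccont (gtop G) f"
      then have c: "ccont (gtop G) (\<lambda>\<gamma>. complex_of_real (f \<gamma>))"
        by (rule ccont_compose) (auto intro!: continuous_intros)
      have "(LINT \<gamma>|L. complex_of_real (f \<gamma>)) = (LINT \<gamma>|haar v. complex_of_real (f \<gamma>))"
        unfolding integral_haar[OF v c] using L c unfolding char by blast
      then show "(LINT \<gamma>|L. f \<gamma>) = (LINT \<gamma>|haar v. f \<gamma>)" by simp
    qed
  qed (use char radon_haar[OF v] integral_haar[OF v] in blast)
qed

text \<open>The complement of the fibre is open, so its measure is a supremum of
  \<open>arrow_functional v f\<close> over functions \<open>f\<close> that vanish on the fibre;
  every arrow sum of such an \<open>f\<close> over arrows with range \<open>v\<close> is
  zero.\<close>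

lemma haar_null_outside_fibre:
  assumes v: "v \<in> units G"
  shows "emeasure (haar v) (arrows G - range_fibre G v) = 0"
proof -
  interpret P: positive_functional "gtop G" "arrow_functional v"
    by (rule positive_functional_arrow[OF v])
  let ?U = "arrows G - range_fibre G v"
  have "openin (gtop G) ?U" using closedin_range_fibre by blast
  then have "emeasure (haar v) ?U = P.content ?U"
    unfolding haar_def by (rule P.emeasure_riesz_open)
  moreover have "arrow_functional v f = 0" if f: "subord (gtop G) ?U f" for f
  proof -
    have "arrow_sum f v w = 0" for w
      unfolding arrow_sum_def
      by (rule infsum_0) (use subord_zero[OF f] in \<open>auto simp: hom_fibre_iff range_fibre_iff\<close>)
    then show ?thesis by (simp add: arrow_functional_def)
  qed
  ultimately show ?thesis
    using subord_zero_fun by (auto simp: P.content_def SUP_constant)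
qed

text \<open>A Urysohn function \<open>f\<close> for the point \<open>p\<close> inside
  \<open>W\<close> has arrow sum at least \<open>1\<close> at the source of \<open>p\<close>. The
  sum is continuous in \<open>w\<close>, hence positive on an open set of units, which is not null
  because \<open>\<nu>\<close> has full support; so the functional is positive at
  \<open>f\<close>.\<close>

lemma haar_pos_on_open:
  assumes p: "p \<in> range_fibre G v" and W: "openin (gtop G) W" "p \<in> W"
  shows "emeasure (haar v) W \<noteq> 0"
proof -
  have pa: "p \<in> arrows G" "rng G p = v" and v: "v \<in> units G" and sp: "src G p \<in> units G"
    using p rng_closed src_closed by (auto simp: range_fibre_iff)
  interpret P: positive_functional "gtop G" "arrow_functional v"
    by (rule positive_functional_arrow[OF v])
  have "compactin (gtop G) {p}" using pa by simp
  then obtain f where f: "subord (gtop G) W f" "f p = 1"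
    using locally_compact_Urysohn[OF locally_compact_gtop Hausdorff_gtop _ W(1), of "{p}"] W(2) by blast
  note fc = subord_ccont[OF f(1)]
  have f0: "0 \<le> f \<gamma>" if "\<gamma> \<in> arrows G" for \<gamma> using subord_range[OF f(1)] that by blast
  have s0: "0 \<le> arrow_sum f v w" for w
    unfolding arrow_sum_def by (rule infsum_nonneg) (simp add: f0 hom_fibre_iff)
  have "sum f {p} \<le> arrow_sum f v (src G p)"
    unfolding arrow_sum_def
    by (rule finite_sum_le_infsum[OF summable_on_hom_fibre[OF fc v sp]])
      (use pa f0 in \<open>auto simp: hom_fibre_iff\<close>)
  then have s1: "1 \<le> arrow_sum f v (src G p)" using f(2) by simp
  let ?N = "{w \<in> topspace (unit_space G). arrow_sum f v w \<in> {0<..}}"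
  have N: "openin (unit_space G) ?N"
    by (rule openin_continuous_map_preimage[OF ccont_cont[OF ccont_arrow_sum[OF fc v]]]) auto
  have "src G p \<in> measure_support (unit_space G) \<nu>"
    using full_\<nu> sp by (simp add: fully_supported_def topspace_unit_space)
  moreover have "src G p \<in> ?N" using s1 sp by (simp add: topspace_unit_space)
  ultimately have "emeasure \<nu> ?N \<noteq> 0" using N unfolding measure_support_def by blast
  have "arrow_functional v f \<noteq> 0"
  proof
    assume "arrow_functional v f = 0"
    then have "AE w in \<nu>. arrow_sum f v w = 0"
      using integral_nonneg_eq_0_iff_AE[OF integrable_arrow_sum[OF fc v]] s0
      by (simp add: arrow_functional_def)
    then have "emeasure \<nu> {w \<in> space \<nu>. \<not> arrow_sum f v w = 0} = 0"
      using radon_open_sets[OF radon_\<nu> N] s0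
      by (intro AE_iff_measurable[THEN iffD1, of ?N, rotated -1, THEN trans[rotated]])
        (auto simp: space_\<nu> topspace_unit_space less_le)
    moreover have "{w \<in> space \<nu>. \<not> arrow_sum f v w = 0} = ?N"
      using s0 by (auto simp: space_\<nu> topspace_unit_space less_le)
    ultimately show False using \<open>emeasure \<nu> ?N \<noteq> 0\<close> by simp
  qed
  moreover have "0 \<le> arrow_functional v f" by (rule P.nonneg[OF fc f0])
  ultimately have "0 < ennreal (arrow_functional v f)" by simp
  also have "\<dots> \<le> P.content W" by (rule P.content_upper[OF f(1)])
  also have "\<dots> = emeasure (haar v) W"
    unfolding haar_def by (rule P.emeasure_riesz_open[OF W(1), symmetric])
  finally show ?thesis by simp
qed

lemma measure_support_haar:
  assumes v: "v \<in> units G"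
  shows "measure_support (gtop G) (haar v) = range_fibre G v"
proof
  have "openin (gtop G) (arrows G - range_fibre G v)" using closedin_range_fibre by blast
  then show "measure_support (gtop G) (haar v) \<subseteq> range_fibre G v"
    using haar_null_outside_fibre[OF v] unfolding measure_support_def by blast
  show "range_fibre G v \<subseteq> measure_support (gtop G) (haar v)"
    using haar_pos_on_open by (auto simp: measure_support_def range_fibre_iff)
qed

text \<open>Restricting to the fibre discards only a null set. Invariance is stated with integrals
  over fibres, so the integral formula is needed in this form.\<close>

lemma integral_haar_fibre:
  fixes f :: "'a \<Rightarrow> complex"
  assumes v: "v \<in> units G" and f: "ccont (gtop G) f"
  shows "(LINT \<gamma>:range_fibre G v|haar v. f \<gamma>) = (LINT w|\<nu>. arrow_sum f v w)"
proof -
  note R = radon_haar[OF v]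
  have rm: "range_fibre G v \<in> sets (haar v)"
    by (rule radon_closed_sets[OF R closedin_range_fibre])
  have fm: "f \<in> borel_measurable (haar v)"
    by (rule radon_borel_measurable[OF R ccont_cont[OF f]])
  have "arrows G - range_fibre G v \<in> null_sets (haar v)"
    using haar_null_outside_fibre[OF v] radon_open_sets[OF R] closedin_range_fibre by blast
  then have "AE \<gamma> in haar v. indicat_real (range_fibre G v) \<gamma> *\<^sub>R f \<gamma> = f \<gamma>"
    by (rule AE_I') (auto simp: radon_space[OF R] indicator_def)
  then have "(LINT \<gamma>|haar v. indicat_real (range_fibre G v) \<gamma> *\<^sub>R f \<gamma>) = (LINT \<gamma>|haar v. f \<gamma>)"
    using rm fm by (intro integral_cong_AE) auto
  then show ?thesis using integral_haar[OF v f] by (simp add: set_lebesgue_integral_def)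
qed

text \<open>
  The translate of \<open>f\<close> by \<open>\<gamma>\<close> lives only on the fibre over \<open>src G \<gamma>\<close>; extending \<open>\<gamma>\<close> to a local
  section \<open>c\<close> of the source map gives an extension of the translate in $C_c(G)$.
\<close>

lemma translate_extension:
  fixes f :: "'a \<Rightarrow> complex"
  assumes \<gamma>: "\<gamma> \<in> arrows G" and f: "ccont (gtop G) f"
  obtains g where "ccont (gtop G) g" "\<And>\<eta>. \<eta> \<in> range_fibre G (src G \<gamma>) \<Longrightarrow> g \<eta> = f (\<gamma> \<cdot> \<eta>)"
proof -
  define v where "v = rng G \<gamma>"
  have "\<gamma> \<in> range_fibre G v" using \<gamma> by (simp add: v_def range_fibre_iff)
  then obtain U V c where c: "local_inverse (fibre_top v) (unit_space G) (src G) U V c" "\<gamma> \<in> U"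
      "c (src G \<gamma>) = \<gamma>" "src G \<gamma> \<in> V" "V \<subseteq> units G"
      "\<And>y. y \<in> V \<Longrightarrow> c y \<in> arrows G \<and> rng G (c y) = v \<and> src G (c y) = y"
      "continuous_map (subtopology (unit_space G) V) (gtop G) c"
    by (rule fibre_section) blast
  have V: "openin (unit_space G) V" using c(1) by (simp add: local_inverse_def)
  have "compactin (unit_space G) {src G \<gamma>}"
    using src_closed[OF \<gamma>] by (simp add: topspace_unit_space)
  then obtain \<phi> where \<phi>: "subord (unit_space G) V \<phi>" "\<phi> (src G \<gamma>) = 1"
    using locally_compact_Urysohn[OF locally_compact_unit_space Hausdorff_unit_space _ V, of "{src G \<gamma>}"] c(4)
    by blast
  then obtain L where L: "compactin (unit_space G) L" "L \<subseteq> V" "\<And>y. y \<in> units G \<Longrightarrow> y \<notin> L \<Longrightarrow> \<phi> y = 0"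
    unfolding subord_def topspace_unit_space by blast
  obtain K where K: "compactin (gtop G) K" "\<And>\<eta>. \<eta> \<in> arrows G \<Longrightarrow> \<eta> \<notin> K \<Longrightarrow> f \<eta> = 0"
    using f by (rule ccontE) blast
  \<comment> \<open>The cutoff \<open>\<phi>\<close> is \<open>1\<close> at the source of
    \<open>\<gamma>\<close>, where \<open>c\<close> takes the value \<open>\<gamma>\<close>, so on
    that fibre \<open>g\<close> is the exact translate; away from it \<open>\<phi>\<close> brings
    \<open>g\<close> to zero before the domain \<open>V\<close> of \<open>c\<close> ends.\<close>
  define g where "g \<eta> = (if rng G \<eta> \<in> V then \<phi> (rng G \<eta>) *\<^sub>R f (c (rng G \<eta>) \<cdot> \<eta>) else 0)" for \<eta>
  have cont: "continuous_map (gtop G) euclidean g"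
  proof (rule continuous_map_locally)
    fix \<eta> assume \<eta>: "\<eta> \<in> arrows G"
    show "\<exists>N. openin (gtop G) N \<and> \<eta> \<in> N \<and> continuous_map (subtopology (gtop G) N) euclidean g"
    proof (cases "rng G \<eta> \<in> V")
      case True
      let ?N = "{\<eta> \<in> arrows G. rng G \<eta> \<in> V}"
      let ?T = "subtopology (gtop G) ?N"
      have N: "openin (gtop G) ?N" by (rule openin_continuous_map_preimage[OF continuous_rng V])
      have r: "continuous_map ?T (unit_space G) (rng G)"
        by (rule continuous_map_from_subtopology[OF continuous_rng])
      then have "continuous_map ?T (subtopology (unit_space G) V) (rng G)"
        by (auto simp: continuous_map_in_subtopology)
      from continuous_map_compose[OF this c(7)]
      have "continuous_map ?T (gtop G) (\<lambda>\<eta>. c (rng G \<eta>))" by (simp add: o_def)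
      then have "continuous_map ?T (gtop G) (\<lambda>\<eta>. c (rng G \<eta>) \<cdot> \<eta>)"
        using c(6) by (intro continuous_map_groupoid_mult) (auto simp: continuous_map_from_subtopology)
      from continuous_map_compose[OF this ccont_cont[OF f]]
      have 1: "continuous_map ?T euclidean (\<lambda>\<eta>. f (c (rng G \<eta>) \<cdot> \<eta>))" by (simp add: o_def)
      from continuous_map_compose[OF r ccont_cont[OF subord_ccont[OF \<phi>(1)]]]
      have 2: "continuous_map ?T euclidean (\<lambda>\<eta>. \<phi> (rng G \<eta>))" by (simp add: o_def)
      have "continuous_map ?T euclidean (\<lambda>\<eta>. \<phi> (rng G \<eta>) *\<^sub>R f (c (rng G \<eta>) \<cdot> \<eta>))"
        using 1 2 unfolding continuous_map_atin by (auto intro: tendsto_scaleR)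
      then have "continuous_map ?T euclidean g"
        by (rule continuous_map_eq) (simp add: g_def)
      then show ?thesis using N True \<eta> by blast
    next
      case False
      \<comment> \<open>Outside \<open>V\<close> continuity is trivial: the carrier \<open>L\<close>
        of \<open>\<phi>\<close> is closed and contained in \<open>V\<close>, so \<open>g\<close> is
        zero on the whole open set of arrows with range outside \<open>L\<close>.\<close>
      let ?N = "{\<eta> \<in> arrows G. rng G \<eta> \<in> topspace (unit_space G) - L}"
      have "openin (unit_space G) (topspace (unit_space G) - L)"
        using compactin_imp_closedin[OF Hausdorff_unit_space L(1)] by blast
      then have N: "openin (gtop G) ?N" by (rule openin_continuous_map_preimage[OF continuous_rng])
      have "continuous_map (subtopology (gtop G) ?N) euclidean g"
        by (rule continuous_map_eq[of _ _ "\<lambda>_. 0"])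
          (use L(3) in \<open>auto simp: g_def topspace_unit_space\<close>)
      moreover have "\<eta> \<in> ?N"
        using False L(2) \<eta> rng_closed by (auto simp: topspace_unit_space)
      ultimately show ?thesis using N by blast
    qed
  qed
  \<comment> \<open>A compact carrier for \<open>g\<close>: where \<open>g\<close> is nonzero, the
    range of \<open>\<eta>\<close> lies in \<open>L\<close> and the translated arrow lies in
    \<open>K\<close> and in the fibre over \<open>v\<close>. Translating back by \<open>?m\<close>
    exhibits \<open>\<eta>\<close> in the continuous image of a compact product.\<close>
  let ?T = "subtopology (prod_topology (unit_space G) (gtop G)) (V \<times> range_fibre G v)"
  let ?D = "L \<times> (range_fibre G v \<inter> K)"
  let ?m = "\<lambda>z. ginv G (c (fst z)) \<cdot> snd z"
  have "compactin (gtop G) (range_fibre G v \<inter> K)"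
    by (rule closed_Int_compactin[OF closedin_range_fibre K(1)])
  then have D: "compactin ?T ?D"
    using L(1,2) by (auto simp: compactin_subtopology compactin_Times)
  have "continuous_map ?T (subtopology (unit_space G) V) fst"
    by (auto simp: continuous_map_in_subtopology continuous_map_from_subtopology continuous_map_fst)
  from continuous_map_compose[OF this c(7)]
  have "continuous_map ?T (gtop G) (\<lambda>z. c (fst z))" by (simp add: o_def)
  then have "continuous_map ?T (gtop G) ?m"
    using c(6) src_inv
    by (intro continuous_map_groupoid_mult continuous_map_groupoid_inv)
      (auto simp: continuous_map_from_subtopology continuous_map_snd range_fibre_iff)
  then have comp: "compactin (gtop G) (?m ` ?D)" by (rule image_compactin[OF D])
  have zero: "g \<eta> = 0" if \<eta>: "\<eta> \<in> arrows G" "\<eta> \<notin> ?m ` ?D" for \<eta>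
  proof (rule ccontr)
    assume nz: "g \<eta> \<noteq> 0"
    then have r: "rng G \<eta> \<in> V" "rng G \<eta> \<in> L"
      using L(3) rng_closed \<eta>(1) by (auto simp: g_def split: if_splits)
    let ?k = "c (rng G \<eta>) \<cdot> \<eta>"
    have k: "?k \<in> range_fibre G v" "ginv G (c (rng G \<eta>)) \<cdot> ?k = \<eta>"
      using c(6)[OF r(1)] \<eta>(1) mult_arrow inv_mult_cancel by (auto simp: range_fibre_iff)
    have "?k \<in> K" using nz r(1) k(1) K(2) by (auto simp: g_def range_fibre_iff)
    then have "\<eta> = ?m (rng G \<eta>, ?k)" "(rng G \<eta>, ?k) \<in> ?D" using k r(2) by auto
    then show False using \<eta>(2) by blast
  qed
  have "ccont (gtop G) g" by (rule ccontI[OF cont comp zero])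
  moreover have "g \<eta> = f (\<gamma> \<cdot> \<eta>)" if "\<eta> \<in> range_fibre G (src G \<gamma>)" for \<eta>
    using that c(3,4) \<phi>(2) by (simp add: g_def range_fibre_iff)
  ultimately show thesis by (rule that)
qed

text \<open>The extension \<open>g\<close> agrees with the translate on the fibre over the source of
  \<open>\<gamma>\<close>, so it may replace the translate in the integral over that fibre; being in
  \<open>ccont\<close>, it admits the integral formula. The two integrands over \<open>\<nu>\<close>
  then agree for each \<open>w\<close>.\<close>

lemma haar_invariant:
  fixes f :: "'a \<Rightarrow> complex"
  assumes \<gamma>: "\<gamma> \<in> arrows G" and f: "ccont (gtop G) f"
  shows "(LINT \<eta>:range_fibre G (src G \<gamma>)|haar (src G \<gamma>). f (\<gamma> \<cdot> \<eta>)) =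
    (LINT \<eta>:range_fibre G (rng G \<gamma>)|haar (rng G \<gamma>). f \<eta>)"
proof -
  obtain g where g: "ccont (gtop G) g" "\<And>\<eta>. \<eta> \<in> range_fibre G (src G \<gamma>) \<Longrightarrow> g \<eta> = f (\<gamma> \<cdot> \<eta>)"
    using translate_extension[OF \<gamma> f] by blast
  have "(LINT \<eta>:range_fibre G (src G \<gamma>)|haar (src G \<gamma>). f (\<gamma> \<cdot> \<eta>)) =
      (LINT \<eta>:range_fibre G (src G \<gamma>)|haar (src G \<gamma>). g \<eta>)"
    unfolding set_lebesgue_integral_def
    by (intro Bochner_Integration.integral_cong refl) (use g(2) in \<open>auto simp: indicator_def\<close>)
  also have "\<dots> = (LINT w|\<nu>. arrow_sum g (src G \<gamma>) w)"
    by (rule integral_haar_fibre[OF src_closed[OF \<gamma>] g(1)])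
  also have "\<dots> = (LINT w|\<nu>. arrow_sum f (rng G \<gamma>) w)"
  proof -
    have "arrow_sum g (src G \<gamma>) w = arrow_sum f (rng G \<gamma>) w" for w
    proof -
      have "arrow_sum g (src G \<gamma>) w = (\<Sum>\<^sub>\<infinity>\<eta> \<in> hom_fibre G (src G \<gamma>) w. f (\<gamma> \<cdot> \<eta>))"
        unfolding arrow_sum_def by (rule infsum_cong) (simp add: g(2) hom_fibre_iff range_fibre_iff)
      also have "\<dots> = arrow_sum f (rng G \<gamma>) w"
        unfolding arrow_sum_def by (rule infsum_reindex_bij_betw[OF bij_betw_left_translation[OF \<gamma>]])
      finally show ?thesis .
    qed
    then show ?thesis by simp
  qed
  also have "\<dots> = (LINT \<eta>:range_fibre G (rng G \<gamma>)|haar (rng G \<gamma>). f \<eta>)"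
    by (rule integral_haar_fibre[OF rng_closed[OF \<gamma>] f, symmetric])
  finally show ?thesis .
qed

theorem haar_system_haar: "haar_system G haar"
  unfolding haar_system_def
proof (intro conjI ballI)
  fix f :: "'a \<Rightarrow> complex" assume "f \<in> Cc (gtop G)"
  then have f: "ccont (gtop G) f" by (simp add: Cc_iff_ccont[OF Hausdorff_gtop])
  have "ccont (unit_space G) (\<lambda>v. LINT w|\<nu>. arrow_sum f v w)"
    using ccont_parameter_integral[OF ccont_arrow_sum_pairs[OF f] radon_\<nu> Hausdorff_unit_space] by simp
  then have "ccont (unit_space G) (\<lambda>u. LINT \<eta>|haar u. f \<eta>)"
    by (rule ccont_cong) (simp add: integral_haar[OF _ f] topspace_unit_space)
  then show "(\<lambda>u. LINT \<eta>|haar u. f \<eta>) \<in> Cc (unit_space G)"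
    by (simp add: Cc_iff_ccont[OF Hausdorff_unit_space])
qed (simp_all add: radon_haar measure_support_haar haar_invariant Cc_iff_ccont[OF Hausdorff_gtop])

end

text \<open>Infinite sums and integrals take the value \<open>0\<close> on divergence, so the first
  conjunct records convergence separately. In the second, the equivalence expresses existence,
  uniqueness and independence of \<open>\<eta>\<close> at once; by local triviality an arrow
  \<open>\<eta>\<close> exists for every \<open>v\<close>.\<close>

theorem mainTheorem6:
  fixes G :: "'g top_groupoid" and \<nu> :: "'g measure" and x :: 'g
  assumes "locally_compact_groupoid G"
    and "locally_trivial G"
    and "radon_measure (unit_space G) \<nu>"
    and "fully_supported (unit_space G) \<nu>"
    and "x \<in> units G"
  shows "(\<forall>v \<in> units G. \<forall>\<eta> \<in> hom_fibre G x v. \<forall>f \<in> Cc (gtop G).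
            (\<forall>w \<in> units G. (\<lambda>\<gamma>. f (ginv G \<eta> \<cdot>\<^bsub>G\<^esub> \<gamma>)) summable_on hom_fibre G x w) \<and>
            integrable \<nu> (\<lambda>w. \<Sum>\<^sub>\<infinity>\<gamma> \<in> hom_fibre G x w. f (ginv G \<eta> \<cdot>\<^bsub>G\<^esub> \<gamma>))) \<and>
         (\<exists>\<Lambda>. (\<forall>v \<in> units G. \<forall>\<eta> \<in> hom_fibre G x v. \<forall>L. is_lambda G \<nu> x \<eta> L \<longleftrightarrow> L = \<Lambda> v) \<and>
              haar_system G \<Lambda>)"
proof -
  interpret haar_data G \<nu>
    using assms unfolding haar_data_def haar_data_axioms_def locally_trivial_groupoid_def
      locally_trivial_groupoid_axioms_def by blast
  have "(\<lambda>\<gamma>. f (ginv G \<eta> \<cdot>\<^bsub>G\<^esub> \<gamma>)) summable_on hom_fibre G x w"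
    if "v \<in> units G" "\<eta> \<in> hom_fibre G x v" "f \<in> Cc (gtop G)" "w \<in> units G" for v \<eta> f w
    using summable_on_hom_fibre[of f v w] that
      summable_on_reindex_bij_betw[OF bij_betw_inv_translation[OF that(2)], of f w]
    by (simp add: Cc_iff_ccont[OF Hausdorff_gtop])
  moreover have "integrable \<nu> (\<lambda>w. \<Sum>\<^sub>\<infinity>\<gamma> \<in> hom_fibre G x w. f (ginv G \<eta> \<cdot>\<^bsub>G\<^esub> \<gamma>))"
    if "v \<in> units G" "\<eta> \<in> hom_fibre G x v" "f \<in> Cc (gtop G)" for v \<eta> f
    using integrable_arrow_sum[of f v] that
    by (simp add: translate_arrow_sum[OF that(2)] Cc_iff_ccont[OF Hausdorff_gtop])
  ultimately show ?thesis using is_lambda_iff haar_system_haar by blast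
qed

end
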